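(* Let $F$ be a field. Let $Q$ be the quiver obtained by gluing two oriented cycles $C(1)=C_n$ and $C(2)=C_m$ at a vertex $v$. Let $\alpha$ be the arrow of $C(1)$ ending in $v$ and let $\beta$ be the arrow of $C(2)$ starting from $v$. Then the algebra $A=FQ/\langle\alpha\beta\rangle$ is PI. More precisely, if $k=\max\{n,m\}$, then the polynomial $$St_{2k}(x_1,\dots,x_{2k})\,St_{2k}(x_{2k+1},\dots,x_{4k})$$ is a polynomial identity for $A$.
   Context: For $n\ge 1$, the oriented cycle $C_n$ is the quiver with $n$ vertices $1,\dots,n$ and $n$ arrows $\alpha_i:i\to i+1$ (indices modulo $n$); $C_1$ is a loop. The quiver obtained by gluing $C_n$ and $C_m$ at a vertex $v$ is the quiver obtained from the disjoint union of $C_n$ and $C_m$ by identifying one vertex of $C_n$ with one vertex of $C_m$, the resulting common vertex being called $v$; all arrows remain distinct. A path of length $r\ge 1$ in a quiver is a sequence $\alpha_1\alpha_2\cdots\alpha_r$ of arrows with $t(\alpha_i)=s(\alpha_{i+1})$, where $s,t$ denote starting and terminal vertices; for each vertex $u$ there is also a lazy path $e_u$ of length $0$ from $u$ to $u$. The path algebra $FQ$ is the $F$-vector space with basis all paths in $Q$ (including lazy paths), with multiplication of paths given by concatenation $pq$ if $t(p)=s(q)$ and $0$ otherwise. $\langle\alpha\beta\rangle$ is the two-sided ideal of $FQ$ generated by the path $\alpha\beta$. A polynomial $f\in F\langle x_1,\dots,x_N\rangle$ in non-commuting variables is a polynomial identity for an associative $F$-algebra $A$ if $f(a_1,\dots,a_N)=0$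 for all $a_1,\dots,a_N\in A$; $A$ is PI if it has a nonzero polynomial identity. The standard polynomial of degree $r$ is $St_r(x_1,\dots,x_r)=\sum_{\sigma\in S_r}\operatorname{sgn}(\sigma)\,x_{\sigma(1)}\cdots x_{\sigma(r)}$. *)

theory Defs
  imports
    "HOL-Combinatorics.Permutations"
    "HOL-Library.Poly_Mapping"
    "Graph_Theory.Arc_Walk"
    "HOL-Algebra.QuotRing"
    "HOL-Algebra.Module"
begin

text \<open>
  A quiver is a \<^typ>\<open>('v, 'e) pre_digraph\<close>: arrows carry their own identity, so loops and
  parallel arrows are allowed; \<^const>\<open>tail\<close> is the starting and \<^const>\<open>head\<close> the terminal vertex.
\<close>

section \<open>Oriented cycles and gluing\<close>

text \<open>The arrow from \<open>i\<close> to the next vertex is itself called \<open>i\<close>.\<close>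

definition oriented_cycle :: "nat \<Rightarrow> (nat, nat) pre_digraph" where
  "oriented_cycle n =
     \<lparr> verts = {1..n}, arcs = {1..n},
       tail = (\<lambda>i. i), head = (\<lambda>i. if i = n then 1 else i + 1) \<rparr>"

text \<open>
  The vertex \<open>w\<close> of \<open>H\<close> is identified with the vertex \<open>u\<close> of \<open>G\<close>; \<open>Inl u\<close> represents
  the resulting common vertex.
\<close>

definition glue ::
  "('v1, 'e1) pre_digraph \<Rightarrow> 'v1 \<Rightarrow> ('v2, 'e2) pre_digraph \<Rightarrow> 'v2
    \<Rightarrow> ('v1 + 'v2, 'e1 + 'e2) pre_digraph" where
  "glue G u H w =
     (let \<iota> = (\<lambda>x. if x = w then Inl u else Inr x)
      in \<lparr> verts = Inl ` verts G \<union> \<iota> ` verts H,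
           arcs = Inl ` arcs G \<union> Inr ` arcs H,
           tail = case_sum (\<lambda>e. Inl (tail G e)) (\<lambda>e. \<iota> (tail H e)),
           head = case_sum (\<lambda>e. Inl (head G e)) (\<lambda>e. \<iota> (head H e)) \<rparr>)"

lemma fin_digraph_oriented_cycle: "fin_digraph (oriented_cycle n)"
  by unfold_locales (auto simp: oriented_cycle_def)

lemma fin_digraph_glue:
  assumes "fin_digraph G" "fin_digraph H" "u \<in> verts G"
  shows "fin_digraph (glue G u H w)"
proof -
  interpret G: fin_digraph G by fact
  interpret H: fin_digraph H by fact
  show ?thesis
    using assms(3) by unfold_locales (auto simp: glue_def Let_def split: if_splits)
qed

section \<open>The path algebra\<close>

text \<open>
  A path is its starting vertex together with its list of arrows; \<open>(u, [])\<close> is the lazy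
  path at \<open>u\<close>.
\<close>

type_synonym ('v, 'e) path = "'v \<times> 'e list"

definition paths :: "('v, 'e) pre_digraph \<Rightarrow> ('v, 'e) path set" where
  "paths Q = {(u, p). \<exists>v. pre_digraph.awalk Q u p v}"

definition path_end :: "('v, 'e) pre_digraph \<Rightarrow> ('v, 'e) path \<Rightarrow> 'v" where
  "path_end Q p = pre_digraph.awlast Q (fst p) (snd p)"

definition path_mult ::
  "('v, 'e) pre_digraph \<Rightarrow> (('v, 'e) path \<Rightarrow>\<^sub>0 'f::field) \<Rightarrow> (('v, 'e) path \<Rightarrow>\<^sub>0 'f)
    \<Rightarrow> (('v, 'e) path \<Rightarrow>\<^sub>0 'f)" where
  "path_mult Q x y =
     (\<Sum>p\<in>Poly_Mapping.keys x. \<Sum>q\<in>Poly_Mapping.keys y.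
        if path_end Q p = fst q
        then Poly_Mapping.single (fst p, snd p @ snd q)
               (Poly_Mapping.lookup x p * Poly_Mapping.lookup y q)
        else 0)"

text \<open>Intended for quivers with finitely many vertices, where the unit exists.\<close>

definition path_algebra ::
  "('v, 'e) pre_digraph \<Rightarrow> ('f::field, ('v, 'e) path \<Rightarrow>\<^sub>0 'f) module" where
  "path_algebra Q =
     \<lparr> carrier = {x. Poly_Mapping.keys x \<subseteq> paths Q},
       mult = path_mult Q,
       one = (\<Sum>u\<in>verts Q. Poly_Mapping.single (u, []) 1),
       zero = 0,
       add = (+),
       smult = (\<lambda>c. Poly_Mapping.map ((*) c)) \<rparr>"

definition path_elem :: "('v, 'e) path \<Rightarrow> (('v, 'e) path \<Rightarrow>\<^sub>0 'f::field)" where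
  "path_elem p = Poly_Mapping.single p 1"

subsection \<open>The path algebra is a ring\<close>

text \<open>So the library notions of generated ideal and quotient ring are meaningful for it.\<close>

definition path_single_mult ::
  "('v, 'e) pre_digraph \<Rightarrow> ('v, 'e) path \<Rightarrow> ('v, 'e) path
    \<Rightarrow> 'f::field \<Rightarrow> (('v, 'e) path \<Rightarrow>\<^sub>0 'f)" where
  "path_single_mult Q p q c =
      (if path_end Q p = fst q then Poly_Mapping.single (fst p, snd p @ snd q) c else 0)"

lemma path_mult_eq: "path_mult Q x y = (\<Sum>p\<in>Poly_Mapping.keys x. \<Sum>q\<in>Poly_Mapping.keys y.
   path_single_mult Q p q (Poly_Mapping.lookup x p * Poly_Mapping.lookup y q))"
  by (simp add: path_mult_def path_single_mult_def)

lemma path_single_mult_0 [simp]: "path_single_mult Q p q 0 = 0"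
  by (simp add: path_single_mult_def)
lemma path_single_mult_add:
      "path_single_mult Q p q (c + d) = path_single_mult Q p q c + path_single_mult Q p q d"
  by (simp add: path_single_mult_def single_add)

lemma path_mult_superset:
  assumes "finite S" "Poly_Mapping.keys x \<subseteq> S" "finite T" "Poly_Mapping.keys y \<subseteq> T"
  shows "path_mult Q x y =
      (\<Sum>p\<in>S. \<Sum>q\<in>T. path_single_mult Q p q (Poly_Mapping.lookup x p * Poly_Mapping.lookup y q))"
proof -
  have "path_mult Q x y =
      (\<Sum>p\<in>Poly_Mapping.keys x. \<Sum>q\<in>T. path_single_mult Q p q (Poly_Mapping.lookup x p * Poly_Mapping.lookup y q))"
    unfolding path_mult_eq
    by (rule sum.cong[OF refl], rule sum.mono_neutral_left) (use assms in \<open>auto simp: in_keys_iff\<close>)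
  also have "\<dots> =
      (\<Sum>p\<in>S. \<Sum>q\<in>T. path_single_mult Q p q (Poly_Mapping.lookup x p * Poly_Mapping.lookup y q))"
    by (rule sum.mono_neutral_left) (use assms in \<open>auto simp: in_keys_iff\<close>)
  finally show ?thesis .
qed

lemma path_mult_add_left: "path_mult Q (x + y) z = path_mult Q x z + path_mult Q y z"
proof -
  let ?S = "Poly_Mapping.keys x \<union> Poly_Mapping.keys y"
  let ?T = "Poly_Mapping.keys z"
  have "path_mult Q (x + y) z =
      (\<Sum>p\<in>?S. \<Sum>q\<in>?T. path_single_mult Q p q (Poly_Mapping.lookup (x+y) p * Poly_Mapping.lookup z q))"
    by (rule path_mult_superset) (auto dest: subsetD[OF keys_add])
  moreover have "path_mult Q x z =
      (\<Sum>p\<in>?S. \<Sum>q\<in>?T. path_single_mult Q p q (Poly_Mapping.lookup x p * Poly_Mapping.lookup z q))"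
    by (rule path_mult_superset) auto
  moreover have "path_mult Q y z =
      (\<Sum>p\<in>?S. \<Sum>q\<in>?T. path_single_mult Q p q (Poly_Mapping.lookup y p * Poly_Mapping.lookup z q))"
    by (rule path_mult_superset) auto
  ultimately show ?thesis by (simp add: lookup_add distrib_right path_single_mult_add sum.distrib)
qed

lemma path_mult_add_right: "path_mult Q z (x + y) = path_mult Q z x + path_mult Q z y"
proof -
  let ?S = "Poly_Mapping.keys x \<union> Poly_Mapping.keys y"
  let ?T = "Poly_Mapping.keys z"
  have "path_mult Q z (x + y) =
      (\<Sum>q\<in>?T. \<Sum>p\<in>?S. path_single_mult Q q p (Poly_Mapping.lookup z q * Poly_Mapping.lookup (x+y) p))"
    by (rule path_mult_superset) (auto dest: subsetD[OF keys_add])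
  moreover have "path_mult Q z x =
      (\<Sum>q\<in>?T. \<Sum>p\<in>?S. path_single_mult Q q p (Poly_Mapping.lookup z q * Poly_Mapping.lookup x p))"
    by (rule path_mult_superset) auto
  moreover have "path_mult Q z y =
      (\<Sum>q\<in>?T. \<Sum>p\<in>?S. path_single_mult Q q p (Poly_Mapping.lookup z q * Poly_Mapping.lookup y p))"
    by (rule path_mult_superset) auto
  ultimately show ?thesis by (simp add: lookup_add distrib_left path_single_mult_add sum.distrib)
qed

lemma path_mult_0 [simp]: "path_mult Q 0 x = 0" "path_mult Q x 0 = 0"
  by (simp_all add: path_mult_def)

lemma path_mult_sum_left: "path_mult Q (sum f S) z = (\<Sum>i\<in>S. path_mult Q (f i) z)"
  by (induction S rule: infinite_finite_induct) (simp_all add: path_mult_add_left)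

lemma path_mult_sum_right: "path_mult Q z (sum f S) = (\<Sum>i\<in>S. path_mult Q z (f i))"
  by (induction S rule: infinite_finite_induct) (simp_all add: path_mult_add_right)

lemma path_mult_single:
  "path_mult Q (Poly_Mapping.single p c) (Poly_Mapping.single q d) = path_single_mult Q p q (c * d)"
  by (simp add: path_mult_eq)

lemma path_end_append:
  "path_end Q (u, p) = w \<Longrightarrow> path_end Q (u, p @ q) = path_end Q (w, q)"
  by (cases "q = []") (auto simp: path_end_def pre_digraph.awalk_verts_conv)

lemma path_mult_single_assoc:
  "path_mult Q (path_mult Q (Poly_Mapping.single p a) (Poly_Mapping.single q b)) (Poly_Mapping.single r c)
   = path_mult Q (Poly_Mapping.single p a) (path_mult Q (Poly_Mapping.single q b) (Poly_Mapping.single r c))"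
  using path_end_append[of Q "fst p" "snd p" _ "snd q"]
  by (auto simp: path_mult_single path_single_mult_def mult.assoc)

lemma poly_mapping_eq_sum: "x =
      (\<Sum>p\<in>Poly_Mapping.keys x. Poly_Mapping.single p (Poly_Mapping.lookup x p))"
  by (rule poly_mapping_eqI) (auto simp: lookup_sum lookup_single when_def in_keys_iff)


lemma path_mult_assoc: "path_mult Q (path_mult Q x y) z = path_mult Q x (path_mult Q y z)"
proof -
  define f where "f = (\<lambda>x :: ('a, 'b) path \<Rightarrow>\<^sub>0 'c. \<lambda>p. Poly_Mapping.single p (Poly_Mapping.lookup x p))"
  have *: "x = sum (f x) (Poly_Mapping.keys x)" for x
    unfolding f_def by (rule poly_mapping_eq_sum)
  have **: "path_mult Q (path_mult Q (f x p) (f y q)) (f z r) = path_mult Q (f x p) (path_mult Q (f y q) (f z r))" for p q r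
    unfolding f_def by (rule path_mult_single_assoc)
  have "path_mult Q (path_mult Q (sum (f x) A) (sum (f y) B)) (sum (f z) C)
    = path_mult Q (sum (f x) A) (path_mult Q (sum (f y) B) (sum (f z) C))" for A B C
    by (simp only: path_mult_sum_left path_mult_sum_right **)
  then show ?thesis using * by metis
qed

lemma (in fin_digraph) path_mult_lazy_left:
  assumes "Poly_Mapping.keys x \<subseteq> paths G"
  shows "path_mult G (\<Sum>u\<in>verts G. Poly_Mapping.single (u, []) 1) x = x"
proof -
  have "path_mult G (\<Sum>u\<in>verts G. Poly_Mapping.single (u, []) 1) (Poly_Mapping.single q c) =
      Poly_Mapping.single q c"
    if "q \<in> paths G" for q c
  proof -
    have "fst q \<in> verts G" using that by (auto simp: paths_def)
    then show ?thesis
      by (simp add: path_mult_sum_left path_mult_single path_single_mult_def path_end_def)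
  qed
  then show ?thesis
    using assms by (subst (1 2) poly_mapping_eq_sum[of x])
      (auto simp: path_mult_sum_right intro!: sum.cong)
qed

lemma (in fin_digraph) path_mult_lazy_right:
  assumes "Poly_Mapping.keys x \<subseteq> paths G"
  shows "path_mult G x (\<Sum>u\<in>verts G. Poly_Mapping.single (u, []) 1) = x"
proof -
  have "path_mult G (Poly_Mapping.single q c) (\<Sum>u\<in>verts G. Poly_Mapping.single (u, []) 1) =
      Poly_Mapping.single q c"
    if "q \<in> paths G" for q c
  proof -
    have "path_end G q \<in> verts G" using that by (auto simp: paths_def path_end_def)
    then show ?thesis
      by (simp add: path_mult_sum_right path_mult_single path_single_mult_def)
  qed
  then show ?thesis
    using assms by (subst (1 2) poly_mapping_eq_sum[of x])
      (auto simp: path_mult_sum_left intro!: sum.cong)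
qed

lemma (in fin_digraph) path_append:
  assumes "p \<in> paths G" "q \<in> paths G" "path_end G p = fst q"
  shows "(fst p, snd p @ snd q) \<in> paths G"
  using assms by (cases p; cases q) (auto simp: paths_def path_end_def intro!: awalk_appendI)

lemma (in fin_digraph) path_mult_closed:
  assumes "Poly_Mapping.keys x \<subseteq> paths G" "Poly_Mapping.keys y \<subseteq> paths G"
  shows "Poly_Mapping.keys (path_mult G x y) \<subseteq> paths G"
  unfolding path_mult_def
  by (intro order.trans[OF keys_sum] UN_least)
    (use assms path_append in \<open>force split: if_splits\<close>)

lemma (in fin_digraph) ring_path_algebra:
      "ring (path_algebra G :: ('f::field, ('a, 'b) path \<Rightarrow>\<^sub>0 'f) module)"
proof (rule ringI)
  show "abelian_group (path_algebra G :: ('f::field, ('a, 'b) path \<Rightarrow>\<^sub>0 'f) module)"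
  proof (rule abelian_groupI, goal_cases)
    case (6 x)
    then show ?case by (intro bexI[of _ "- x"]) (auto simp: path_algebra_def)
  qed (auto simp: path_algebra_def add_ac dest: subsetD[OF keys_add])
  show "Group.monoid (path_algebra G :: ('f::field, ('a, 'b) path \<Rightarrow>\<^sub>0 'f) module)"
  proof (rule monoidI, goal_cases)
    case (2)
    have "(u, []) \<in> paths G" if "u \<in> verts G" for u
      using that by (auto simp: paths_def awalk_Nil_iff)
    then show ?case by (auto simp: path_algebra_def dest!: subsetD[OF keys_sum] split: if_splits)
  next
    case (1 x y)
    then show ?case using path_mult_closed[of x y] by (simp add: path_algebra_def)
  qed (use path_mult_lazy_left path_mult_lazy_right in \<open>auto simp: path_algebra_def path_mult_assoc\<close>)
qed (auto simp: path_algebra_def path_mult_add_left path_mult_add_right)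

section \<open>Quotient algebras\<close>

text \<open>
  The library quotient ring \<^term>\<open>A Quot I\<close> with the induced scalar multiplication
  \<open>c (I + x) = I + c x\<close>.
\<close>

definition quotient_algebra :: "('f, 'a, 'b) module_scheme \<Rightarrow> 'a set \<Rightarrow> ('f, 'a set) module" where
  "quotient_algebra A I =
     ring.extend (A Quot I)
       (module.fields (\<lambda>c X. \<Union>x\<in>X. I +>\<^bsub>A\<^esub> (c \<odot>\<^bsub>A\<^esub> x)))"

lemma quotient_algebra_simps [simp]:
  "carrier (quotient_algebra A I) = carrier (A Quot I)"
  "mult (quotient_algebra A I) = mult (A Quot I)"
  "one (quotient_algebra A I) = one (A Quot I)"
  "zero (quotient_algebra A I) = zero (A Quot I)"
  "add (quotient_algebra A I) = add (A Quot I)"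
  "smult (quotient_algebra A I) = (\<lambda>c X. \<Union>x\<in>X. I +>\<^bsub>A\<^esub> (c \<odot>\<^bsub>A\<^esub> x))"
  by (simp_all add: quotient_algebra_def ring.defs module.defs)


lemma lookup_scale: "Poly_Mapping.lookup (Poly_Mapping.map ((*) (c::'f::field)) x) p =
      c * Poly_Mapping.lookup x p"
  by (simp add: Poly_Mapping.map.rep_eq when_def)

lemma lookup_path_single_mult_scale: "Poly_Mapping.lookup (path_single_mult Q p q (c * d)) k =
      c * Poly_Mapping.lookup (path_single_mult Q p q d) k"
  by (simp add: path_single_mult_def lookup_single when_def)

lemma path_mult_scale_left: "path_mult Q (Poly_Mapping.map ((*) c) x) y =
      Poly_Mapping.map ((*) c) (path_mult Q x y)"
proof -
  have "path_mult Q (Poly_Mapping.map ((*) c) x) y =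
     (\<Sum>p\<in>Poly_Mapping.keys x. \<Sum>q\<in>Poly_Mapping.keys y. path_single_mult Q p q (Poly_Mapping.lookup (Poly_Mapping.map ((*) c) x) p * Poly_Mapping.lookup y q))"
    by (rule path_mult_superset) (auto simp: in_keys_iff lookup_scale)
  then show ?thesis
    by (intro poly_mapping_eqI)
      (simp add: lookup_scale path_mult_eq[of Q x y] lookup_sum mult.assoc lookup_path_single_mult_scale sum_distrib_left)
qed

lemma (in fin_digraph) quotient_smult:
  fixes I :: "(('a, 'b) path \<Rightarrow>\<^sub>0 'f::field) set"
  assumes I: "ideal I (path_algebra G)" and x: "x \<in> carrier (path_algebra G)"
  shows "c \<odot>\<^bsub>quotient_algebra (path_algebra G) I\<^esub> (I +>\<^bsub>path_algebra G\<^esub> x)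
    = I +>\<^bsub>path_algebra G\<^esub> (c \<odot>\<^bsub>path_algebra G\<^esub> x)"
proof -
  let ?R = "path_algebra G :: ('f, ('a, 'b) path \<Rightarrow>\<^sub>0 'f) module"
  interpret ideal I ?R by fact
  have cl: "c \<odot>\<^bsub>?R\<^esub> y \<in> carrier ?R" if "y \<in> carrier ?R" for y
    using that by (auto simp: path_algebra_def in_keys_iff lookup_scale)
  have add: "c \<odot>\<^bsub>?R\<^esub> (y \<oplus>\<^bsub>?R\<^esub> z) = (c \<odot>\<^bsub>?R\<^esub> y) \<oplus>\<^bsub>?R\<^esub> (c \<odot>\<^bsub>?R\<^esub> z)" for y z
    by (simp add: path_algebra_def) (intro poly_mapping_eqI, simp add: lookup_scale lookup_add distrib_left)
  have one: "c \<odot>\<^bsub>?R\<^esub> y = (c \<odot>\<^bsub>?R\<^esub> \<one>\<^bsub>?R\<^esub>) \<otimes>\<^bsub>?R\<^esub> y" if "y \<in> carrier ?R" for y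
    using that by (simp add: path_algebra_def path_mult_scale_left path_mult_lazy_left)
  have cI: "c \<odot>\<^bsub>?R\<^esub> y \<in> I" if "y \<in> I" for y
  proof -
    have "(c \<odot>\<^bsub>?R\<^esub> \<one>\<^bsub>?R\<^esub>) \<otimes>\<^bsub>?R\<^esub> y \<in> I"
      using that cl[OF one_closed] by (rule I_l_closed)
    then show ?thesis
      using one[of y] a_subset that by auto
  qed
  have "I +>\<^bsub>?R\<^esub> (c \<odot>\<^bsub>?R\<^esub> y) = I +>\<^bsub>?R\<^esub> (c \<odot>\<^bsub>?R\<^esub> x)" if y: "y \<in> I +>\<^bsub>?R\<^esub> x" for y
  proof -
    obtain i where i: "i \<in> I" "y = i \<oplus>\<^bsub>?R\<^esub> x" using y by (auto simp: a_r_coset_def')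
    have "c \<odot>\<^bsub>?R\<^esub> y \<in> I +>\<^bsub>?R\<^esub> (c \<odot>\<^bsub>?R\<^esub> x)"
      using i cI[of i] by (auto simp: a_r_coset_def' add)
    from a_repr_independence[OF this cl[OF x] a_subgroup] show ?thesis by (rule sym)
  qed
  moreover have "x \<in> I +>\<^bsub>?R\<^esub> x" using a_rcos_self x by blast
  ultimately show ?thesis
    unfolding quotient_algebra_simps by blast
qed

section \<open>Polynomial identities\<close>

text \<open>Words in the variables, i.e. the free monoid, written additively as exponents of monomials.\<close>

datatype nc_word = Word (letters: "nat list")

instantiation nc_word :: monoid_add
begin

definition zero_nc_word :: nc_word where
  "0 = Word []"

definition plus_nc_word :: "nc_word \<Rightarrow> nc_word \<Rightarrow> nc_word" where
  "a + b = Word (letters a @ letters b)"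

instance
  by standard (simp_all add: zero_nc_word_def plus_nc_word_def)

end

text \<open>
  The free algebra in countably many variables; its ring structure is the library's
  convolution product. It is the union of the free algebras in finitely many variables.
\<close>

type_synonym 'f nc_poly = "nc_word \<Rightarrow>\<^sub>0 'f"

definition nc_var :: "nat \<Rightarrow> 'f::field nc_poly" where
  "nc_var i = Poly_Mapping.single (Word [i]) 1"

definition nc_eval :: "('f::field, 'a, 'b) module_scheme \<Rightarrow> (nat \<Rightarrow> 'a) \<Rightarrow> 'f nc_poly \<Rightarrow> 'a" where
  "nc_eval A a f =
     (\<Oplus>\<^bsub>A\<^esub>w\<in>Poly_Mapping.keys f.
        Poly_Mapping.lookup f w \<odot>\<^bsub>A\<^esub> foldr (\<lambda>i y. a i \<otimes>\<^bsub>A\<^esub> y) (letters w) \<one>\<^bsub>A\<^esub>)"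

definition polynomial_identity :: "('f::field, 'a, 'b) module_scheme \<Rightarrow> 'f nc_poly \<Rightarrow> bool" where
  "polynomial_identity A f \<longleftrightarrow>
     (\<forall>a. (\<forall>i. a i \<in> carrier A) \<longrightarrow> nc_eval A a f = \<zero>\<^bsub>A\<^esub>)"

definition PI_algebra :: "('f::field, 'a, 'b) module_scheme \<Rightarrow> bool" where
  "PI_algebra A \<longleftrightarrow> (\<exists>f. f \<noteq> 0 \<and> polynomial_identity A f)"

text \<open>\<open>St r y\<close> is the standard polynomial of degree \<open>r\<close> in \<open>y 1, \<dots>, y r\<close>.\<close>

definition St :: "nat \<Rightarrow> (nat \<Rightarrow> 'a) \<Rightarrow> 'a::ring_1" where
  "St r y =
     (\<Sum>\<sigma> | \<sigma> permutes {1..r}.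
        of_int (sign \<sigma>) * prod_list (map (\<lambda>i. y (\<sigma> i)) [1..<Suc r]))"

end

theory Submission
  imports Defs "HOL-Combinatorics.Cycles"
begin

text \<open>
  By multilinearity, the coefficient of a value of \<open>St_2k\<close> at a path inside one of the two cycles
  is a signed count of the orders in which \<open>2k\<close> given paths compose to it. In a cycle a path is
  determined by its start and length, so this counts orderings of \<open>2k\<close> arcs on at most \<open>k\<close>
  vertices into trails with given ends, which is zero by the Amitsur-Levitzki theorem.
  Hence values of \<open>St_2k\<close> are combinations of paths using arrows of both cycles. In a product of
  two such paths an arrow of \<open>C(1)\<close> is followed later by one of \<open>C(2)\<close>, and the only passage
  from \<open>C(1)\<close> to \<open>C(2)\<close> is \<open>\<alpha>\<beta>\<close>.

  The Amitsur-Levitzki theorem is proved for arcs (that is, matrix units) by Razmyslov's argument: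
  in the fundamental trace identity
  \<open>\<Sum>\<sigma>. sgn \<sigma> tr_\<sigma>(Y_1, \<dots>, Y_k, B) = 0\<close>, \<open>\<sigma> \<in> S_{k+1}\<close>, substitute products of
  pairs of matrices for the \<open>Y_j\<close> and alternate over all \<open>2k\<close> matrices. Any cycle of \<open>\<sigma>\<close>
  avoiding \<open>B\<close> gives the alternating trace of an even number of matrices, which vanishes by
  rotation; the full cycles all contribute the same value, a multiple of \<open>tr(St_2k B)\<close>.
\<close>

section \<open>Signed counts of trails\<close>

text \<open>Reindexing by \<open>c\<close> on the right turns the sum into its own negative. The
  values are integers, so this forces \<open>0\<close>; the field, possibly of characteristic 2,
  enters only later through \<open>of_int\<close>.\<close>

lemma sum_sign_eq_0_if_odd:
  fixes F :: "('a \<Rightarrow> 'a) \<Rightarrow> int"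
  assumes "finite S" "c permutes S" "sign c = -1"
    and F: "\<And>\<pi>. \<pi> permutes S \<Longrightarrow> F (\<pi> \<circ> c) = F \<pi>"
  shows "(\<Sum>\<pi> | \<pi> permutes S. sign \<pi> * F \<pi>) = 0"
proof -
  have "(\<Sum>\<pi> | \<pi> permutes S. sign \<pi> * F \<pi>) = (\<Sum>\<pi> | \<pi> permutes S. sign (\<pi> \<circ> c) * F (\<pi> \<circ> c))"
    by (rule sum_permutations_compose_right[OF assms(2)])
  also have "\<dots> = (\<Sum>\<pi> | \<pi> permutes S. - (sign \<pi> * F \<pi>))"
    using assms by (intro sum.cong refl)
      (auto simp: F sign_compose permutes_imp_permutation)
  finally show ?thesis by (simp add: sum_negf)
qed

lemma sign_cycle_of_list:
  "distinct cs \<Longrightarrow> sign (cycle_of_list cs) = (-1) ^ (length cs - 1)"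
proof (induction cs rule: cycle_of_list.induct)
  case (1 i j cs)
  then have "sign (transpose i j \<circ> cycle_of_list (j # cs)) = - ((-1) ^ (length (j # cs) - 1))"
    by (subst sign_compose) (auto simp: permutation_of_cycle sign_swap_id permutation_swap_id)
  then show ?case by (simp add: comp_def)
qed auto

text \<open>
  Position \<open>0\<close> holds the extra matrix \<open>B\<close>, positions \<open>2j+1, 2j+2\<close> the two factors of a \<open>Y\<close>;
  the permutation sends a position to the one that follows it in the product of traces.
\<close>

definition trail_perms :: "nat \<Rightarrow> (nat \<Rightarrow> nat) set" where
  "trail_perms k = {\<rho>. \<rho> permutes {..2*k} \<and> (\<forall>p<2*k. odd p \<longrightarrow> \<rho> p = Suc p)}"

text \<open>As a trail permutation with \<open>N = 2*k\<close> this is the one whose product of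
  traces is the single trace of \<open>B x_1 ... x_2k\<close>.\<close>

definition cyclic_succ :: "nat \<Rightarrow> nat \<Rightarrow> nat" where
  "cyclic_succ N p = (if p < N then Suc p else if p = N then 0 else p)"

lemma cyclic_succ_permutes: "cyclic_succ N permutes {..N}"
  by (rule inj_imp_permutes) (auto simp: cyclic_succ_def inj_on_def split: if_splits)

lemma cyclic_succ_funpow: "p \<le> N \<Longrightarrow> (cyclic_succ N ^^ p) 0 = p"
  by (induction p) (auto simp: cyclic_succ_def)

lemma finite_trail_perms: "finite (trail_perms k)"
  by (rule finite_subset[OF _ finite_permutations[of "{..2*k}"]]) (auto simp: trail_perms_def)

lemma cyclic_succ_trail_perms: "cyclic_succ (2 * k) \<in> trail_perms k"
  by (auto simp: trail_perms_def cyclic_succ_permutes cyclic_succ_def)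

text \<open>Arc \<open>\<pi> p\<close> is placed at position \<open>p\<close>; \<open>s\<close> and \<open>t\<close> give the start and end of an arc.\<close>

definition joins :: "nat \<Rightarrow> (nat \<Rightarrow> 'v) \<Rightarrow> (nat \<Rightarrow> 'v) \<Rightarrow> (nat \<Rightarrow> nat) \<Rightarrow> (nat \<Rightarrow> nat) \<Rightarrow> bool" where
  "joins k s t \<rho> \<pi> \<longleftrightarrow> (\<forall>p\<le>2*k. t (\<pi> p) = s (\<pi> (\<rho> p)))"

text \<open>A nonzero even position is already the image of the odd position before it, so by
  injectivity no even position is sent there. Cycles can therefore enter a pair only at its odd
  member.\<close>

lemma trail_perms_parity:
  assumes "\<rho> \<in> trail_perms k" "even p" "p \<le> 2 * k"
  shows "\<rho> p = 0 \<or> odd (\<rho> p)"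
proof (rule ccontr)
  assume *: "\<not> ?thesis"
  have r: "\<rho> permutes {..2*k}" "\<And>p. p<2*k \<Longrightarrow> odd p \<Longrightarrow> \<rho> p = Suc p"
    using assms by (auto simp: trail_perms_def)
  have le: "\<rho> p \<le> 2 * k" using permutes_in_image[OF r(1), of p] assms by auto
  with * have "\<rho> (\<rho> p - 1) = \<rho> p" using r(2)[of "\<rho> p - 1"] by auto
  then have "\<rho> p - 1 = p" using permutes_inj[OF r(1)] by (auto dest: injD)
  moreover have "\<rho> p \<noteq> 0" "even (\<rho> p)" using * by auto
  ultimately show False using assms(2) by presburger
qed

text \<open>The fundamental trace identity on arcs, by pigeonhole: two of the \<open>k + 1\<close>
  blocks (\<open>B\<close> and the \<open>k\<close> pairs) start at the same vertex. Exchanging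
  these two starts as targets of \<open>\<rho>\<close> preserves \<open>joins\<close> and reverses
  the sign.\<close>

lemma sum_trail_perms_eq_0:
  assumes V: "finite V" "card V \<le> k" and s: "\<And>i. i \<le> 2 * k \<Longrightarrow> s i \<in> V"
    and \<pi>: "\<pi> permutes {..2*k}"
  shows "(\<Sum>\<rho>\<in>trail_perms k. sign \<rho> * of_bool (joins k s t \<rho> \<pi>)) = (0::int)"
proof -
  \<comment> \<open>The positions where blocks begin: \<open>0\<close> for \<open>B\<close> and the
    odd member of each pair.\<close>
  let ?D = "insert 0 ((\<lambda>j. 2 * j + 1) ` {..<k})"
  have cD: "card ?D = Suc k"
    by (subst card_insert_disjoint) (auto simp: card_image inj_on_def)
  have "card ((\<lambda>i. s (\<pi> i)) ` ?D) \<le> card V"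
  proof (rule card_mono[OF V(1)], clarify)
    fix i assume "i \<in> ?D"
    then have "i \<le> 2 * k" by auto
    then have "\<pi> i \<le> 2 * k" using permutes_in_image[OF \<pi>, of i] by auto
    then show "s (\<pi> i) \<in> V" by (rule s)
  qed
  then have "\<not> inj_on (\<lambda>i. s (\<pi> i)) ?D"
    using V(2) cD by (metis Suc_n_not_le_n card_image order.trans)
  then obtain a b where ab: "a \<in> ?D" "b \<in> ?D" "a \<noteq> b" "s (\<pi> a) = s (\<pi> b)"
    unfolding inj_on_def by metis
  have abl: "a \<le> 2 * k" "b \<le> 2 * k" using ab by auto
  define \<tau> where "\<tau> = transpose a b"
  have tt: "\<tau> \<circ> (\<tau> \<circ> \<rho>) = \<rho>" for \<rho> by (simp add: \<tau>_def fun_eq_iff)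
  have tp: "\<tau> permutes {..2*k}" unfolding \<tau>_def using abl by (intro permutes_swap_id) auto
  \<comment> \<open>\<open>\<tau>\<close> moves only block starts, so the prescribed links from odd
    positions, whose targets are even and nonzero, survive.\<close>
  have ev: "\<tau> q = q" if "even q" "q \<noteq> 0" for q
    using that ab(1,2) unfolding \<tau>_def by (intro transpose_apply_other) auto
  have mem: "\<tau> \<circ> \<rho> \<in> trail_perms k" if "\<rho> \<in> trail_perms k" for \<rho>
    using that tp permutes_compose[OF _ tp] by (auto simp: trail_perms_def ev)
  have st: "s (\<pi> (\<tau> q)) = s (\<pi> q)" for q
    using ab(4) by (auto simp: \<tau>_def transpose_def)
  have sg: "sign (\<tau> \<circ> \<rho>) = - sign \<rho>" if "\<rho> \<in> trail_perms k" for \<rho>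
  proof -
    have "permutation \<rho>" using that by (auto simp: trail_perms_def intro: permutes_imp_permutation[rotated])
    then show ?thesis
      using ab(3) by (simp add: \<tau>_def sign_compose permutation_swap_id sign_swap_id)
  qed
  let ?f = "\<lambda>\<rho>. sign \<rho> * of_bool (joins k s t \<rho> \<pi>) :: int"
  have "sum ?f (trail_perms k) = (\<Sum>\<rho>\<in>trail_perms k. - ?f \<rho>)"
    by (rule sum.reindex_bij_witness[of _ "(\<circ>) \<tau>" "(\<circ>) \<tau>"])
      (auto simp: tt mem sg joins_def st)
  then show ?thesis by (simp add: sum_negf)
qed

lemma permutes_atMost_if:
  "\<pi> permutes {1..N::nat} \<Longrightarrow> \<pi> permutes {..N}"
  by (erule permutes_subset) auto

text \<open>The rotation argument for alternating traces of even length: the cycle of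
  \<open>x\<close> avoids \<open>0\<close>, alternates between odd and even positions, and so gives
  an odd permutation \<open>c\<close>. It commutes with \<open>\<rho>\<close>, hence passing from
  \<open>\<pi>\<close> to \<open>\<pi> \<circ> c\<close> preserves \<open>joins\<close>.\<close>

lemma sum_non_cyclic_eq_0:
  assumes \<rho>: "\<rho> \<in> trail_perms k" and x: "x \<le> 2 * k" "\<And>l. x \<noteq> (\<rho> ^^ l) 0"
  shows "(\<Sum>\<pi> | \<pi> permutes {1..2*k}. sign \<pi> * of_bool (joins k s t \<rho> \<pi>)) = (0::int)"
proof -
  have r: "\<rho> permutes {..2*k}" "\<And>p. p<2*k \<Longrightarrow> odd p \<Longrightarrow> \<rho> p = Suc p"
    using \<rho> by (auto simp: trail_perms_def)
  have perm: "permutation \<rho>" using r(1) by (auto intro: permutes_imp_permutation[rotated])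
  define cs where "cs = support \<rho> x"
  define c where "c = cycle_of_list cs"
  have d: "distinct cs" unfolding cs_def by (rule cycle_of_permutation[OF perm])
  have setcs: "set cs = range (\<lambda>i. (\<rho> ^^ i) x)" unfolding cs_def by (rule support_set[OF perm])
  have n0: "(\<rho> ^^ i) x \<noteq> 0" for i
  proof
    assume e: "(\<rho> ^^ i) x = 0"
    have "0 \<in> set (support \<rho> x)" using e unfolding support_set[OF perm] by (metis rangeI)
    moreover have "0 \<in> set (support \<rho> 0)" 
      unfolding support_set[OF perm] by (metis funpow_0 rangeI)
    ultimately have "set (support \<rho> x) \<inter> set (support \<rho> 0) \<noteq> {}" by blast
    then have "x \<in> set (support \<rho> 0)" using disjoint_support'[OF perm] by blast
    then show False using x(2) unfolding support_set[OF perm] by auto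
  qed
  have le: "(\<rho> ^^ i) x \<le> 2 * k" for i
    using permutes_in_image[OF permutes_funpow[OF r(1)], of i x] x(1) by auto
  have par: "even ((\<rho> ^^ Suc i) x) = odd ((\<rho> ^^ i) x)" for i
  proof (cases "even ((\<rho> ^^ i) x)")
    case True
    then show ?thesis using trail_perms_parity[OF \<rho>, of "(\<rho> ^^ i) x"] le n0[of "Suc i"] by auto
  next
    case False
    then have "(\<rho> ^^ i) x < 2 * k" using le[of i] by (metis dvd_triv_left le_neq_implies_less)
    then show ?thesis using False r(2) by auto
  qed
  have "even ((\<rho> ^^ i) x) = (even i = even x)" for i
    by (induction i) (use par in auto)
  \<comment> \<open>After one full turn the orbit is back at \<open>x\<close>, so alternating parity
    forces an even length.\<close>
  from this[of "least_power \<rho> x"] have ev: "even (length cs)"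
    using least_power_of_permutation[OF perm, of x] by (metis cs_def diff_zero length_map length_upt)
  have "length cs > 0" using least_power_of_permutation[OF perm, of x] by (simp add: cs_def)
  with ev have odd: "odd (length cs - 1)" by presburger
  have sgn: "sign c = -1" using sign_cycle_of_list[OF d] odd by (simp add: c_def)
  \<comment> \<open>Avoiding \<open>0\<close> keeps \<open>B\<close> in place, so \<open>c\<close>
    may be used to reindex the permutations \<open>\<pi>\<close> of \<open>{1..2*k}\<close>.\<close>
  have cs_sub: "set cs \<subseteq> {1..2*k}" using n0 le by (auto simp: setcs Suc_le_eq)
  have cp: "c permutes {1..2*k}" unfolding c_def by (rule permutes_subset[OF cycle_permutes cs_sub])
  have cr: "c q = (if q \<in> set cs then \<rho> q else q)" for q
    using cycle_restrict[OF perm, of q x] id_outside_supp[of q cs] by (auto simp: c_def cs_def)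
  have mem: "\<rho> q \<in> set cs \<longleftrightarrow> q \<in> set cs" for q
  proof
    assume "q \<in> set cs"
    then obtain i where "q = (\<rho> ^^ i) x" by (auto simp: setcs)
    then have "\<rho> q = (\<rho> ^^ Suc i) x" by simp
    then show "\<rho> q \<in> set cs" unfolding setcs by blast
  next
    assume a: "\<rho> q \<in> set cs"
    then have "\<rho> q \<in> c ` set cs"
      using permutes_image[OF cycle_permutes[of cs]] by (simp add: c_def)
    then obtain q' where "q' \<in> set cs" "\<rho> q = \<rho> q'" using cr by auto
    then show "q \<in> set cs" using permutes_inj[OF r(1)] by (auto dest: injD)
  qed
  have comm: "c (\<rho> q) = \<rho> (c q)" for q by (simp add: cr mem)
  have cb: "c permutes {..2*k}" by (rule permutes_atMost_if[OF cp])
  have "joins k s t \<rho> (\<pi> \<circ> c) = joins k s t \<rho> \<pi>" for \<pi>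
  proof -
    have "joins k s t \<rho> (\<pi> \<circ> c) \<longleftrightarrow> (\<forall>p\<in>{..2*k}. t (\<pi> (c p)) = s (\<pi> (\<rho> (c p))))"
      by (simp add: joins_def comm atMost_def)
    also have "\<dots> \<longleftrightarrow> (\<forall>p\<in>c ` {..2*k}. t (\<pi> p) = s (\<pi> (\<rho> p)))" by blast
    finally show ?thesis unfolding permutes_image[OF cb] by (simp only: joins_def[of k s t \<rho> \<pi>] Ball_def atMost_iff)
  qed
  then show ?thesis by (intro sum_sign_eq_0_if_odd[OF _ cp sgn]) auto
qed

text \<open>Listing the cycle from \<open>0\<close> gives a permutation \<open>q\<close> that
  conjugates \<open>cyclic_succ (2*k)\<close> to \<open>\<rho>\<close>. Conjugation gives the
  equality of signs, and reindexing by \<open>q\<close> turns one sum into the other;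
  \<open>q\<close> is even because it permutes whole pairs.\<close>

lemma sum_cyclic_eq:
  assumes \<rho>: "\<rho> \<in> trail_perms k" and x: "\<And>x. x \<le> 2 * k \<Longrightarrow> \<exists>l. x = (\<rho> ^^ l) 0"
  shows "(\<Sum>\<pi> | \<pi> permutes {1..2*k}. sign \<pi> * of_bool (joins k s t \<rho> \<pi>)) =
      (\<Sum>\<pi> | \<pi> permutes {1..2*k}. sign \<pi> * of_bool (joins k s t (cyclic_succ (2*k)) \<pi>) :: int)"
    and "sign \<rho> = sign (cyclic_succ (2*k))"
proof -
  have r: "\<rho> permutes {..2*k}" "\<And>p. p<2*k \<Longrightarrow> odd p \<Longrightarrow> \<rho> p = Suc p"
    using \<rho> by (auto simp: trail_perms_def)
  have perm: "permutation \<rho>" using r(1) by (auto intro: permutes_imp_permutation[rotated])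
  define q where "q = (\<lambda>l. if l \<le> 2 * k then (\<rho> ^^ l) 0 else l)"
  have le: "(\<rho> ^^ i) 0 \<le> 2 * k" for i
    using permutes_in_image[OF permutes_funpow[OF r(1)], of i 0] by auto
  have "set (support \<rho> 0) = {..2*k}"
    unfolding support_set[OF perm] using x le by (auto simp: image_iff)
  then have lp: "least_power \<rho> 0 = Suc (2 * k)"
    using distinct_card[OF cycle_of_permutation[OF perm, of 0]] by simp
  have inj: "inj_on (\<lambda>i. (\<rho> ^^ i) 0) {..2*k}"
    using cycle_of_permutation[OF perm, of 0] unfolding distinct_map lp
    by (auto simp: atLeast0LessThan lessThan_Suc_atMost simp del: upt_Suc)
  have qp: "q permutes {..2*k}"
    by (rule inj_imp_permutes) (use le inj in \<open>auto simp: q_def inj_on_def\<close>)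
  have q0: "q 0 = 0" by (simp add: q_def)
  have ne0: "(\<rho> ^^ i) 0 \<noteq> 0" if "i \<noteq> 0" "i \<le> 2 * k" for i
    using inj_onD[OF inj, of i 0] that by auto
  \<comment> \<open>Since \<open>0\<close> does not recur among the listed positions, parity
    alternates along the list, and \<open>q\<close> sends odd positions to odd ones.\<close>
  have par: "even ((\<rho> ^^ i) 0) = even i" if "i \<le> 2 * k" for i
    using that
  proof (induction i)
    case (Suc i)
    show ?case
    proof (cases "even i")
      case True
      then show ?thesis using trail_perms_parity[OF \<rho>, of "(\<rho> ^^ i) 0"] Suc le[of i] ne0[of "Suc i"] by auto
    next
      case False
      then have "odd ((\<rho> ^^ i) 0)" using Suc by auto
      moreover have "(\<rho> ^^ i) 0 < 2 * k" using calculation le[of i] by (metis dvd_triv_left le_neq_implies_less)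
      ultimately show ?thesis using False r(2) by auto
    qed
  qed auto
  have qpar: "even (q i) = even i" for i by (simp add: q_def par)
  have qSuc: "q (Suc i) = Suc (q i)" if "odd i" "i < 2 * k" for i
  proof -
    have "odd ((\<rho> ^^ i) 0)" using that par by auto
    moreover have "(\<rho> ^^ i) 0 < 2 * k" using calculation le[of i] by (metis dvd_triv_left le_neq_implies_less)
    ultimately show ?thesis using that r(2) by (auto simp: q_def)
  qed
  have qr: "\<rho> (q i) = q (cyclic_succ (2*k) i)" for i
  proof -
    have "(\<rho> ^^ Suc (2 * k)) 0 = 0" using least_power_of_permutation[OF perm, of 0] lp by simp
    then show ?thesis using permutes_not_in[OF r(1), of i] by (auto simp: q_def cyclic_succ_def)
  qed
  have perm0: "permutation (cyclic_succ (2*k))"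
    using cyclic_succ_permutes by (auto intro: permutes_imp_permutation[rotated])
  have permq: "permutation q" using qp by (auto intro: permutes_imp_permutation[rotated])
  have "sign (\<rho> \<circ> q) = sign (q \<circ> cyclic_succ (2*k))" using qr by (simp add: comp_def)
  then show "sign \<rho> = sign (cyclic_succ (2*k))"
    using sign_nz[of q] by (simp add: sign_compose perm perm0 permq)

  \<comment> \<open>\<open>q\<close> moves the pairs \<open>{2j+1, 2j+2}\<close> as blocks, so it is the product of its restriction
    to the odd positions and a conjugate of that restriction.\<close>
  define T where "T = (\<lambda>p. if p = 0 \<or> p > 2 * k then p else if odd p then Suc p else p - 1)"
  define E where "E = (\<lambda>p. if odd p then q p else p)"
  have cases4: "p = 0 \<or> p > 2 * k \<or> odd p \<and> p < 2 * k \<or> (\<exists>r. p = Suc r \<and> odd r \<and> r < 2 * k)" for p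
    by (cases p) (auto simp: not_less less_Suc_eq_le le_less)
  have TT: "T (T p) = p" for p
    using cases4[of p] by (elim disjE exE conjE) (simp_all add: T_def odd_pos)
  have Tp: "T permutes {..2*k}"
  proof (rule inj_imp_permutes)
    show "inj_on T {..2*k}" by (metis TT inj_onI)
    show "T p \<in> {..2*k}" if "p \<in> {..2*k}" for p
      using cases4[of p] that by (elim disjE exE conjE) (simp_all add: T_def odd_pos)
  qed (auto simp: T_def)
  have Ep: "E permutes {..2*k}"
  proof (rule inj_imp_permutes)
    show "inj_on E {..2*k}"
      using permutes_inj[OF qp] qpar by (auto simp: E_def inj_on_def dest: injD) 
    show "E p \<in> {..2*k}" if "p \<in> {..2*k}" for p
      using that le by (auto simp: E_def q_def)
  qed (auto simp: E_def q_def)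
  \<comment> \<open>The inner \<open>T \<circ> (E \<circ> T)\<close> is the conjugate, which acts on
    the even positions. As \<open>E\<close> and \<open>T\<close> both occur twice, the sign is
    \<open>1\<close>.\<close>
  have qE: "q = E \<circ> (T \<circ> (E \<circ> T))"
  proof
    fix p
    consider "p = 0" | "p > 2 * k" | "odd p" "p < 2 * k" | r where "p = Suc r" "odd r" "r < 2 * k"
      using cases4[of p] by blast
    then show "q p = (E \<circ> (T \<circ> (E \<circ> T))) p"
    proof cases
      case 3
      then show ?thesis by (auto simp: T_def E_def)
    next
      case 4
      then have "odd (q r)" "q r \<le> 2 * k" "q r \<noteq> 0" using qpar[of r] le by (auto simp: q_def elim: oddE)
      then show ?thesis using 4 qSuc[of r] by (auto simp: T_def E_def qpar)
    qed (auto simp: T_def E_def q_def)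
  qed
  have "permutation T" "permutation E" using Tp Ep by (auto intro: permutes_imp_permutation[rotated])
  then have sq: "sign q = 1"
    unfolding qE by (simp add: sign_compose permutation_compose sign_idempotent mult.left_commute
      flip: mult.assoc)
  have qp1: "q permutes {1..2*k}"
    by (rule permutes_superset[OF qp]) (auto simp: q0 Suc_le_eq)
  have J: "joins k s t \<rho> \<pi> \<longleftrightarrow> joins k s t (cyclic_succ (2*k)) (\<pi> \<circ> q)" for \<pi>
  proof -
    have "joins k s t (cyclic_succ (2*k)) (\<pi> \<circ> q) \<longleftrightarrow> (\<forall>p\<in>{..2*k}. t (\<pi> (q p)) = s (\<pi> (\<rho> (q p))))"
      by (simp add: joins_def qr atMost_def)
    also have "\<dots> \<longleftrightarrow> (\<forall>p\<in>q ` {..2*k}. t (\<pi> p) = s (\<pi> (\<rho> p)))" by blast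
    finally show ?thesis unfolding permutes_image[OF qp] by (simp only: joins_def[of k s t \<rho> \<pi>] Ball_def atMost_iff)
  qed
  have sg: "sign (\<pi> \<circ> q) = sign \<pi>" if "\<pi> permutes {1..2*k}" for \<pi>
    using that sq permq by (subst sign_compose) (auto intro: permutes_imp_permutation[rotated])
  show "(\<Sum>\<pi> | \<pi> permutes {1..2*k}. sign \<pi> * of_bool (joins k s t \<rho> \<pi>)) =
      (\<Sum>\<pi> | \<pi> permutes {1..2*k}. sign \<pi> * of_bool (joins k s t (cyclic_succ (2*k)) \<pi>) :: int)"
    by (subst (2) sum_permutations_compose_right[OF qp1]) (auto simp: J sg)
qed

text \<open>The Amitsur-Levitzki theorem on arcs. The double sum over \<open>\<rho>\<close> and
  \<open>\<pi>\<close> vanishes by the trace identity for each fixed \<open>\<pi>\<close>; for fixed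
  \<open>\<rho>\<close> only the full cycles contribute, each with the same value, so a positive
  multiple of the wanted count is zero up to sign.\<close>

lemma signed_trails_eq_0:
  assumes V: "finite V" "card V \<le> k" and s: "\<And>i. i \<le> 2 * k \<Longrightarrow> s i \<in> V"
  shows "(\<Sum>\<pi> | \<pi> permutes {1..2*k}. sign \<pi> * of_bool (\<forall>p\<le>2*k. t (\<pi> p) = s (\<pi> (cyclic_succ (2*k) p))))
    = (0::int)" (is "?H = 0")
proof -
  let ?S = "\<lambda>\<rho>. \<Sum>\<pi> | \<pi> permutes {1..2*k}. sign \<pi> * of_bool (joins k s t \<rho> \<pi>) :: int"
  define C where "C = {\<rho>\<in>trail_perms k. \<forall>x\<le>2*k. \<exists>l. x = (\<rho> ^^ l) 0}"
  have H: "?H = ?S (cyclic_succ (2*k))" by (simp add: joins_def)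
  have "(\<Sum>\<rho>\<in>trail_perms k. sign \<rho> * ?S \<rho>) =
      (\<Sum>\<pi> | \<pi> permutes {1..2*k}. sign \<pi> * (\<Sum>\<rho>\<in>trail_perms k. sign \<rho> * of_bool (joins k s t \<rho> \<pi>)))"
    unfolding sum_distrib_left by (subst sum.swap) (simp add: mult.left_commute)
  also have "\<dots> = 0"
    by (intro sum.neutral) (auto simp: sum_trail_perms_eq_0[OF V s] permutes_atMost_if)
  finally have "0 = (\<Sum>\<rho>\<in>trail_perms k. sign \<rho> * ?S \<rho>)" by simp
  also have "\<dots> = (\<Sum>\<rho>\<in>C. sign \<rho> * ?S \<rho>)"
  proof (rule sum.mono_neutral_right[OF finite_trail_perms], goal_cases)
    case 2
    show ?case
    proof
      fix \<rho> assume "\<rho> \<in> trail_perms k - C"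
      then obtain x where "\<rho> \<in> trail_perms k" "x \<le> 2 * k" "\<And>l. x \<noteq> (\<rho> ^^ l) 0"
        by (auto simp: C_def)
      then have "?S \<rho> = 0" by (rule sum_non_cyclic_eq_0)
      then show "sign \<rho> * ?S \<rho> = 0" by simp
    qed
  qed (auto simp: C_def)
  also have "\<dots> = (\<Sum>\<rho>\<in>C. sign (cyclic_succ (2*k)) * ?S (cyclic_succ (2*k)))"
  proof (intro sum.cong refl)
    fix \<rho> assume "\<rho> \<in> C"
    then have a: "\<rho> \<in> trail_perms k" "\<And>x. x \<le> 2 * k \<Longrightarrow> \<exists>l. x = (\<rho> ^^ l) 0" by (auto simp: C_def)
    show "sign \<rho> * ?S \<rho> = sign (cyclic_succ (2*k)) * ?S (cyclic_succ (2*k))"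
      by (intro arg_cong2[of _ _ _ _ "(*)"] sum_cyclic_eq[OF a])
  qed
  also have "\<dots> = of_nat (card C) * (sign (cyclic_succ (2*k)) * ?H)"
    unfolding H by simp
  \<comment> \<open>Cancelling \<open>card C\<close> is legitimate because the counts are integers;
    in the field it might be zero.\<close>
  finally have "of_nat (card C) * (sign (cyclic_succ (2*k)) * ?H) = 0" by simp
  moreover have "cyclic_succ (2*k) \<in> C"
    using cyclic_succ_trail_perms by (auto simp: C_def intro: cyclic_succ_funpow[symmetric])
  moreover have "finite C" unfolding C_def using finite_trail_perms by simp
  ultimately show ?thesis unfolding mult_eq_0_iff of_nat_eq_0_iff card_eq_0_iff using sign_nz by blast
qed

section \<open>Values of standard polynomials in path algebras\<close>

abbreviation scale :: "'f::field \<Rightarrow> ('a \<Rightarrow>\<^sub>0 'f) \<Rightarrow> ('a \<Rightarrow>\<^sub>0 'f)" where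
  "scale c \<equiv> Poly_Mapping.map ((*) c)"

lemma scale_add: "scale (c::'f::field) (x + y) = scale c x + scale c y"
  by (intro poly_mapping_eqI) (simp add: lookup_scale lookup_add distrib_left)

lemma scale_0 [simp]: "scale (c::'f::field) 0 = 0" "scale (0::'f) x = 0"
  by (intro poly_mapping_eqI; simp add: lookup_scale)+

lemma scale_add_left: "scale (c + d :: 'f::field) x = scale c x + scale d x"
  by (intro poly_mapping_eqI) (simp add: lookup_scale lookup_add distrib_right)

lemma scale_scale: "scale (c::'f::field) (scale d x) = scale (c * d) x"
  by (intro poly_mapping_eqI) (simp add: lookup_scale mult.assoc)

lemma scale_sum: "scale (c::'f::field) (sum f A) = (\<Sum>i\<in>A. scale c (f i))"
  by (induction A rule: infinite_finite_induct) (simp_all add: scale_add)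

lemma path_mult_scale_right:
  "path_mult Q x (scale c y) = scale c (path_mult Q x y)"
proof -
  have "path_mult Q x (scale c y) =
      (\<Sum>p\<in>Poly_Mapping.keys x. \<Sum>q\<in>Poly_Mapping.keys y.
        path_single_mult Q p q (Poly_Mapping.lookup x p * Poly_Mapping.lookup (scale c y) q))"
    by (rule path_mult_superset) (auto simp: in_keys_iff lookup_scale)
  then show ?thesis
    by (intro poly_mapping_eqI)
      (simp add: lookup_scale path_mult_eq[of Q x y] lookup_sum mult.left_commute
        lookup_path_single_mult_scale sum_distrib_left)
qed

text \<open>The fold matches the monomials of \<open>nc_eval\<close>, with the unit of the path
  algebra written out, so that evaluation in the quotient can be lifted to representatives.\<close>

definition word_val :: "('v, 'e) pre_digraph \<Rightarrow> (nat \<Rightarrow> (('v, 'e) path \<Rightarrow>\<^sub>0 'f::field)) \<Rightarrow> nat list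
    \<Rightarrow> (('v, 'e) path \<Rightarrow>\<^sub>0 'f)" where
  "word_val Q x ws =
     foldr (\<lambda>i y. path_mult Q (x i) y) ws (\<Sum>u\<in>verts Q. Poly_Mapping.single (u, []) 1)"

section \<open>Multilinear expansion of words and standard polynomials\<close>

lemma word_val_Cons: "word_val Q x (i # ws) = path_mult Q (x i) (word_val Q x ws)"
  by (simp add: word_val_def)

lemma word_val_cong: "(\<And>i. i \<in> set ws \<Longrightarrow> x i = y i) \<Longrightarrow> word_val Q x ws = word_val Q y ws"
  unfolding word_val_def by (rule foldr_cong) auto

lemma word_val_map: "word_val Q x (map f ws) = word_val Q (x \<circ> f) ws"
  by (simp add: word_val_def foldr_map comp_def)

text \<open>The variable \<open>j\<close> occurs exactly once in the word, so the value is additive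
  in it.\<close>

lemma word_val_sum:
  assumes "distinct ws" "j \<in> set ws"
  shows "word_val Q (x(j := \<Sum>q\<in>K. f q)) ws = (\<Sum>q\<in>K. word_val Q (x(j := f q)) ws)"
  using assms
proof (induction ws)
  case (Cons i ws)
  show ?case
  proof (cases "i = j")
    case True
    then have w: "word_val Q (x(j := a)) ws = word_val Q x ws" for a
      using Cons.prems by (intro word_val_cong) auto
    show ?thesis unfolding True word_val_Cons w fun_upd_same path_mult_sum_left ..
  next
    case False
    then show ?thesis using Cons by (simp add: word_val_Cons path_mult_sum_right)
  qed
qed simp

definition std_val :: "('v, 'e) pre_digraph \<Rightarrow> nat \<Rightarrow> (nat \<Rightarrow> (('v, 'e) path \<Rightarrow>\<^sub>0 'f::field))
    \<Rightarrow> (('v, 'e) path \<Rightarrow>\<^sub>0 'f)" where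
  "std_val Q r x =
     (\<Sum>\<sigma> | \<sigma> permutes {1..r}. scale (of_int (sign \<sigma>)) (word_val Q x (map \<sigma> [1..<Suc r])))"

lemma set_map_permutes: "\<sigma> permutes {1..r} \<Longrightarrow> set (map \<sigma> [1..<Suc r]) = {1..r}"
  using permutes_image[of \<sigma> "{1..r}"] by (simp add: atLeastLessThanSuc_atLeastAtMost del: upt_Suc)

lemma std_val_sum:
  assumes "j \<in> {1..r}"
  shows "std_val Q r (x(j := \<Sum>q\<in>K. f q)) = (\<Sum>q\<in>K. std_val Q r (x(j := f q)))"
proof -
  have "std_val Q r (x(j := \<Sum>q\<in>K. f q)) =
      (\<Sum>\<sigma> | \<sigma> permutes {1..r}. \<Sum>q\<in>K. scale (of_int (sign \<sigma>)) (word_val Q (x(j := f q)) (map \<sigma> [1..<Suc r])))"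
    unfolding std_val_def
  proof (intro sum.cong refl)
    fix \<sigma> assume "\<sigma> \<in> {\<sigma>. \<sigma> permutes {1..r}}"
    then have s: "\<sigma> permutes {1..r}" by simp
    have d: "distinct (map \<sigma> [1..<Suc r])"
      using permutes_inj[OF s] by (simp add: distinct_map inj_on_def inj_def del: upt_Suc)
    show "scale (of_int (sign \<sigma>)) (word_val Q (x(j := \<Sum>q\<in>K. f q)) (map \<sigma> [1..<Suc r])) =
       (\<Sum>q\<in>K. scale (of_int (sign \<sigma>)) (word_val Q (x(j := f q)) (map \<sigma> [1..<Suc r])))"
      using word_val_sum[OF d, of j Q x f K] assms unfolding set_map_permutes[OF s] by (simp add: scale_sum)
  qed
  also have "\<dots> = (\<Sum>q\<in>K. std_val Q r (x(j := f q)))"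
    unfolding std_val_def by (rule sum.swap)
  finally show ?thesis .
qed

lemma std_val_cong: "(\<And>i. i \<in> {1..r} \<Longrightarrow> x i = y i) \<Longrightarrow> std_val Q r x = std_val Q r y"
  unfolding std_val_def
  by (intro sum.cong refl arg_cong2[of _ _ _ _ scale] word_val_cong) (metis mem_Collect_eq set_map_permutes)

text \<open>Reduction to single paths: the arguments are expanded one after another, using
  additivity in each variable.\<close>

lemma lookup_std_val_eq_0I:
  fixes x :: "nat \<Rightarrow> (('v, 'e) path \<Rightarrow>\<^sub>0 'f::field)"
  assumes single: "\<And>h (c :: nat \<Rightarrow> 'f). (\<And>i. h i \<in> P) \<Longrightarrow>
      Poly_Mapping.lookup (std_val Q r (\<lambda>i. Poly_Mapping.single (h i) (c i))) p = 0"
    and P: "P \<noteq> {}" and x: "\<And>i. Poly_Mapping.keys (x i) \<subseteq> P"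
  shows "Poly_Mapping.lookup (std_val Q r x) p = 0"
proof -
  from P obtain p0 where p0: "p0 \<in> P" by auto
  \<comment> \<open>\<open>J\<close> contains the positions that may still be unexpanded; everywhere
    else \<open>y\<close> is a multiple of one path.\<close>
  have *: "Poly_Mapping.lookup (std_val Q r y) p = 0"
    if "finite J" "J \<subseteq> {1..r}" "\<And>i. Poly_Mapping.keys (y i) \<subseteq> P"
      "\<And>i. i \<notin> J \<Longrightarrow> \<exists>h\<in>P. \<exists>c. y i = Poly_Mapping.single h c" for J and y :: "nat \<Rightarrow> (('v, 'e) path \<Rightarrow>\<^sub>0 'f)"
    using that
  proof (induction J arbitrary: y rule: finite_induct)
    case empty
    then obtain h c where "\<And>i. h i \<in> P \<and> y i = Poly_Mapping.single (h i) (c i)" by (metis empty_iff)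
    then have "y = (\<lambda>i. Poly_Mapping.single (h i) (c i))" "\<And>i. h i \<in> P" by auto
    then show ?case using single[of h c] by simp
  next
    case (insert j J)
    have "std_val Q r y = std_val Q r (y(j := \<Sum>q\<in>Poly_Mapping.keys (y j). Poly_Mapping.single q (Poly_Mapping.lookup (y j) q)))"
      unfolding poly_mapping_eq_sum[symmetric] by simp
    also have "\<dots> = (\<Sum>q\<in>Poly_Mapping.keys (y j). std_val Q r (y(j := Poly_Mapping.single q (Poly_Mapping.lookup (y j) q))))"
      using insert.prems by (intro std_val_sum) auto
    also have "Poly_Mapping.lookup \<dots> p = 0"
      unfolding lookup_sum
    proof (intro sum.neutral ballI insert.IH)
      fix q assume q: "q \<in> Poly_Mapping.keys (y j)"
      then show "Poly_Mapping.keys ((y(j := Poly_Mapping.single q (Poly_Mapping.lookup (y j) q))) i) \<subseteq> P" for i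
        using insert.prems(2) by (auto split: if_splits)
      show "\<exists>h\<in>P. \<exists>c. (y(j := Poly_Mapping.single q (Poly_Mapping.lookup (y j) q))) i = Poly_Mapping.single h c"
        if "i \<notin> J" for i
        using that insert.prems(2)[of j] insert.prems(3)[of i] q by auto
    qed (use insert.prems in auto)
    finally show ?case .
  qed
  \<comment> \<open>Variables beyond \<open>r\<close> do not affect the value. They are set to zero,
    written as a multiple of \<open>p0\<close>, so that only finitely many positions need
    expanding.\<close>
  define y where "y i = (if i \<in> {1..r} then x i else Poly_Mapping.single p0 0)" for i
  have "Poly_Mapping.lookup (std_val Q r y) p = 0"
    by (rule *[of "{1..r}"]) (use x p0 in \<open>auto simp: y_def intro: single_zero\<close>)
  moreover have "std_val Q r y = std_val Q r x" by (intro std_val_cong) (simp add: y_def)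
  ultimately show ?thesis by simp
qed

section \<open>Coefficients at paths inside a set of arrows with distinct tails\<close>

context fin_digraph
begin

lemma word_val_carrier:
  assumes "\<And>i. Poly_Mapping.keys (x i) \<subseteq> paths G"
  shows "Poly_Mapping.keys (word_val G x ws) \<subseteq> paths G"
proof (induction ws)
  case Nil
  have "(u, []) \<in> paths G" if "u \<in> verts G" for u
    using that by (auto simp: paths_def awalk_Nil_iff)
  then show ?case by (auto simp: word_val_def dest!: subsetD[OF keys_sum] split: if_splits)
qed (use assms in \<open>simp add: word_val_Cons path_mult_closed\<close>)

lemma word_val_append:
  assumes "\<And>i. Poly_Mapping.keys (x i) \<subseteq> paths G"
  shows "word_val G x (ws @ vs) = path_mult G (word_val G x ws) (word_val G x vs)"
proof (induction ws)
  case Nil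
  then show ?case
    using path_mult_lazy_left[OF word_val_carrier[OF assms, where ws=vs]]
    by (simp add: word_val_def[of _ _ "[]"])
qed (simp add: word_val_Cons path_mult_assoc)

text \<open>The empty word is excluded: its value is the sum of all lazy paths.\<close>

lemma word_val_single:
  assumes "\<And>i. h i \<in> paths G" "ws \<noteq> []"
  shows "word_val G (\<lambda>i. Poly_Mapping.single (h i) (c i)) ws =
    (if successively (\<lambda>a b. path_end G (h a) = fst (h b)) ws
     then Poly_Mapping.single (fst (h (hd ws)), concat (map (snd \<circ> h) ws)) (prod_list (map c ws))
     else 0)"
  using assms(2)
proof (induction ws rule: list_nonempty_induct)
  case (single i)
  have "path_mult G (Poly_Mapping.single (h i) (c i)) (\<Sum>u\<in>verts G. Poly_Mapping.single (u, []) 1)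
      = Poly_Mapping.single (h i) (c i)"
    by (rule path_mult_lazy_right) (use assms(1) in auto)
  then show ?case by (simp add: word_val_def)
next
  case (cons i ws)
  then show ?case
    by (auto simp: word_val_Cons path_mult_single path_single_mult_def successively_Cons comp_def)
qed

lemma composite_path:
  assumes "qs \<noteq> []" "set qs \<subseteq> paths G" "successively (\<lambda>p q. path_end G p = fst q) qs"
  shows "(fst (hd qs), concat (map snd qs)) \<in> paths G"
    and "path_end G (fst (hd qs), concat (map snd qs)) = path_end G (last qs)"
  using assms
proof (induction qs rule: list_nonempty_induct)
  case (cons q qs)
  {
    case 1
    then show ?case
      using cons path_append[of q "(fst (hd qs), concat (map snd qs))"] by (auto simp: successively_Cons)
  next
    case 2
    then show ?case
      using cons path_end_append[of G "fst q" "snd q" "path_end G q"] by (auto simp: successively_Cons)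
  }
qed simp_all

text \<open>With distinct tails there is at most one arrow of \<open>E\<close> to continue with at
  each vertex, so start and length determine the path.\<close>

lemma path_eqI_length:
  assumes "inj_on (tail G) E" "(u, a) \<in> paths G" "(u, b) \<in> paths G" "set a \<subseteq> E" "set b \<subseteq> E"
    and "length a = length b"
  shows "a = b"
  using assms(6,2-5)
proof (induction a b arbitrary: u rule: list_induct2)
  case (Cons e a f b)
  then have "tail G e = tail G f" by (auto simp: paths_def awalk_Cons_iff)
  then have "e = f" using Cons.prems inj_onD[OF assms(1)] by auto
  moreover have "(head G e, a) \<in> paths G" "(head G f, b) \<in> paths G"
    using Cons.prems by (auto simp: paths_def awalk_Cons_iff)
  ultimately show ?case using Cons by auto
qed simp

lemma path_end_closed:
  assumes "\<And>e. e \<in> E \<Longrightarrow> e \<in> arcs G \<Longrightarrow> head G e \<in> W"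
    and "p \<in> paths G" "fst p \<in> W" "set (snd p) \<subseteq> E"
  shows "path_end G p \<in> W"
proof (cases "snd p" rule: rev_cases)
  case (snoc xs e)
  then have "e \<in> arcs G" using assms(2) by (auto simp: paths_def awalk_def)
  then show ?thesis using assms snoc by (auto simp: path_end_def awalk_verts_conv)
qed (use assms in \<open>simp add: path_end_def\<close>)

text \<open>Each factor starts where the previous one ends, and arrows of \<open>E\<close> end in
  \<open>W\<close>.\<close>

lemma composite_starts:
  assumes "\<And>e. e \<in> E \<Longrightarrow> e \<in> arcs G \<Longrightarrow> head G e \<in> W"
    and "qs \<noteq> []" "set qs \<subseteq> paths G" "successively (\<lambda>p q. path_end G p = fst q) qs"
    and "fst (hd qs) \<in> W" "set (concat (map snd qs)) \<subseteq> E"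
  shows "\<forall>q\<in>set qs. fst q \<in> W"
  using assms(2-)
proof (induction qs rule: list_nonempty_induct)
  case (cons q qs)
  have "path_end G q \<in> W" by (rule path_end_closed[OF assms(1)]) (use cons.prems in auto)
  then show ?case using cons by (auto simp: successively_Cons)
qed simp

text \<open>\<open>E\<close> and \<open>W\<close> stand for the arrows and vertices of one cycle.
  For single paths as arguments, the coefficient is a product of scalars times the signed count of
  the orders in which they compose to \<open>p\<close>, and \<open>signed_trails_eq_0\<close> makes
  this count vanish.\<close>

lemma lookup_std_val_eq_0:
  assumes E: "inj_on (tail G) E" and W: "finite W" "card W \<le> k"
    and EW: "\<And>e. e \<in> E \<Longrightarrow> e \<in> arcs G \<Longrightarrow> head G e \<in> W"
    and p: "p \<in> paths G" "fst p \<in> W" "set (snd p) \<subseteq> E"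
    and x: "\<And>i. Poly_Mapping.keys (x i) \<subseteq> paths G"
  shows "Poly_Mapping.lookup (std_val G (2 * k) x) p = 0"
proof (rule lookup_std_val_eq_0I[OF _ _ x])
  show "paths G \<noteq> {}" using p(1) by blast
next
  fix h :: "nat \<Rightarrow> ('a, 'b) path" and c :: "nat \<Rightarrow> 'c"
  assume h: "\<And>i. h i \<in> paths G"
  have k: "k > 0" using W p(2) by (auto simp: card_gt_0_iff intro: Nat.gr0I)
  define L where "L = [1..<Suc (2 * k)]"
  have L: "L \<noteq> []" "hd L = 1" "last L = 2 * k" "length L = 2 * k" "\<And>i. i < 2 * k \<Longrightarrow> L ! i = Suc i"
    using k by (auto simp: L_def hd_upt simp del: upt_Suc)
  have setL: "set L = {1..2*k}" and dL: "distinct L" by (auto simp: L_def)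
  let ?N = "2 * k"
  let ?qs = "\<lambda>\<sigma>. map (h \<circ> \<sigma>) L"
  define ok where "ok \<sigma> \<longleftrightarrow> successively (\<lambda>p q. path_end G p = fst q) (?qs \<sigma>) \<and>
      fst (h (\<sigma> 1)) = fst p \<and> concat (map snd (?qs \<sigma>)) = snd p" for \<sigma>
  \<comment> \<open>The scalars commute, so every order contributes the same product of the
    \<open>c i\<close>.\<close>
  have ws: "Poly_Mapping.lookup (word_val G (\<lambda>i. Poly_Mapping.single (h i) (c i)) (map \<sigma> L)) p
      = of_bool (ok \<sigma>) * (\<Prod>i\<in>{1..?N}. c i)" if \<sigma>: "\<sigma> permutes {1..?N}" for \<sigma>
  proof -
    have "prod_list (map c (map \<sigma> L)) = (\<Prod>i\<in>{1..?N}. c (\<sigma> i))"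
      using prod.distinct_set_conv_list[OF dL, of "\<lambda>i. c (\<sigma> i)"] by (simp add: setL comp_def)
    also have "\<dots> = (\<Prod>i\<in>{1..?N}. c i)"
      using prod.permute[OF \<sigma>, of c] by (simp add: comp_def)
    finally have "prod_list (map c (map \<sigma> L)) = (\<Prod>i\<in>{1..?N}. c i)" .
    moreover have "map \<sigma> L \<noteq> []" using L(1) by simp
    moreover have "(fst (h (\<sigma> 1)), concat (map (snd \<circ> h) (map \<sigma> L))) = p \<longleftrightarrow>
        fst (h (\<sigma> 1)) = fst p \<and> concat (map snd (?qs \<sigma>)) = snd p"
      by (cases p) (simp add: comp_def)
    ultimately show ?thesis
      using L(1,2) by (auto simp: word_val_single[of h, OF h] ok_def successively_map hd_map lookup_single when_def comp_def)
  qed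
  have set_qs: "set (?qs \<sigma>) = h ` {1..?N}" if "\<sigma> permutes {1..?N}" for \<sigma>
    unfolding set_map setL image_comp[symmetric] permutes_image[OF that] ..
  have "(\<Sum>\<sigma> | \<sigma> permutes {1..?N}. sign \<sigma> * of_bool (ok \<sigma>)) = (0::int)"
  \<comment> \<open>This condition does not depend on \<open>\<sigma>\<close>. Where it fails, no
    order of the paths can give \<open>p\<close>.\<close>
  proof (cases "(\<forall>i\<in>{1..?N}. fst (h i) \<in> W \<and> set (snd (h i)) \<subseteq> E) \<and>
      (\<Sum>i\<in>{1..?N}. length (snd (h i))) = length (snd p)")
    case True
    \<comment> \<open>Arc \<open>0\<close> runs back from the end of \<open>p\<close> to its start and closes the trail.\<close>
    define s where "s i = (if i = 0 then path_end G p else fst (h i))" for i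
    define t where "t i = (if i = 0 then fst p else path_end G (h i))" for i
    have ok_iff: "ok \<sigma> \<longleftrightarrow> (\<forall>l\<le>?N. t (\<sigma> l) = s (\<sigma> (cyclic_succ ?N l)))"
      if \<sigma>: "\<sigma> permutes {1..?N}" for \<sigma>
    proof -
      have s0: "\<sigma> 0 = 0" "\<And>l. \<sigma> (Suc l) \<noteq> 0"
        using permutes_not_in[OF \<sigma>, of 0] inj_eq[OF permutes_inj[OF \<sigma>], of _ 0] by auto
      have ne: "?qs \<sigma> \<noteq> []" using L(1) by simp
      have sub: "set (?qs \<sigma>) \<subseteq> paths G" using h by auto
      have hdq: "fst (hd (?qs \<sigma>)) = fst (h (\<sigma> 1))" "last (?qs \<sigma>) = h (\<sigma> ?N)"
        using L by (simp_all add: hd_map last_map)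
      have len: "length (concat (map snd (?qs \<sigma>))) = length (snd p)"
      proof -
        have "length (concat (map snd (?qs \<sigma>))) = (\<Sum>i\<in>{1..?N}. length (snd (h (\<sigma> i))))"
          using sum.distinct_set_conv_list[OF dL, of "\<lambda>i. length (snd (h (\<sigma> i)))"]
            by (simp add: length_concat setL comp_def)
        also have "\<dots> = (\<Sum>i\<in>{1..?N}. length (snd (h i)))"
          using sum.permute[OF \<sigma>, of "\<lambda>i. length (snd (h i))"] by (simp add: comp_def)
        finally show ?thesis using True by simp
      qed
      have setE: "set (concat (map snd (?qs \<sigma>))) \<subseteq> E"
        unfolding set_concat set_map[of snd] set_qs[OF \<sigma>] using True by auto
      have chain: "successively (\<lambda>p q. path_end G p = fst q) (?qs \<sigma>) \<longleftrightarrow>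
          (\<forall>l<?N. l > 0 \<longrightarrow> t (\<sigma> l) = s (\<sigma> (Suc l)))" (is "?S \<longleftrightarrow> ?T")
      proof -
        have "?S \<longleftrightarrow> (\<forall>i. Suc i < ?N \<longrightarrow> path_end G (h (\<sigma> (Suc i))) = fst (h (\<sigma> (Suc (Suc i)))))"
          unfolding successively_conv_nth by (simp add: L(4,5) cong: conj_cong imp_cong)
        also have "\<dots> \<longleftrightarrow> ?T"
        proof -
          have "t (\<sigma> (Suc i)) = path_end G (h (\<sigma> (Suc i)))" "s (\<sigma> (Suc i)) = fst (h (\<sigma> (Suc i)))" for i
            by (simp_all add: s_def t_def s0(2) del: neq0_conv)
          then show ?thesis unfolding gr0_conv_Suc by auto
        qed
        finally show ?thesis .
      qed
      \<comment> \<open>As \<open>\<sigma>\<close> fixes \<open>0\<close>, the closing arc sits at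
        position \<open>0\<close>: the link at \<open>0\<close> fixes the start of the composite,
        the link at \<open>2*k\<close> its end.\<close>
      have "(\<forall>l\<le>?N. t (\<sigma> l) = s (\<sigma> (cyclic_succ ?N l))) \<longleftrightarrow>
          ?T \<and> fst p = fst (h (\<sigma> 1)) \<and> path_end G (h (\<sigma> ?N)) = path_end G p"
      proof -
        have split: "(\<forall>l\<le>?N. R l) \<longleftrightarrow> (\<forall>l<?N. l > 0 \<longrightarrow> R l) \<and> R 0 \<and> R ?N" for R
          using k by (auto simp: le_less dest: spec[of _ 0])
        have N0: "\<sigma> ?N \<noteq> 0" using s0(2)[of "?N - 1"] k by simp
        have mid: "(\<forall>l<?N. l > 0 \<longrightarrow> t (\<sigma> l) = s (\<sigma> (cyclic_succ ?N l))) \<longleftrightarrow> ?T"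
          by (simp add: cyclic_succ_def)
        have "t (\<sigma> 0) = s (\<sigma> (cyclic_succ ?N 0)) \<longleftrightarrow> fst p = fst (h (\<sigma> 1))"
          using k s0(1) s0(2)[of 0] by (simp add: cyclic_succ_def s_def t_def del: neq0_conv)
        moreover have "t (\<sigma> ?N) = s (\<sigma> (cyclic_succ ?N ?N)) \<longleftrightarrow> path_end G (h (\<sigma> ?N)) = path_end G p"
          using N0 s0(1) by (simp add: cyclic_succ_def s_def t_def del: neq0_conv)
        ultimately show ?thesis unfolding split mid by simp
      qed
      \<comment> \<open>Equality of the arrows comes for free: both paths stay in \<open>E\<close>
        and share start and length.\<close>
      moreover have "concat (map snd (?qs \<sigma>)) = snd p"
        if "?S" "fst (h (\<sigma> 1)) = fst p"
      proof (rule path_eqI_length[OF E _ _ setE p(3) len])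
        show "(fst p, concat (map snd (?qs \<sigma>))) \<in> paths G"
          using composite_path(1)[OF ne sub that(1)] unfolding hdq that(2) .
      qed (use p in simp)
      moreover have "path_end G (h (\<sigma> ?N)) = path_end G p"
        if "?S" "fst (h (\<sigma> 1)) = fst p" "concat (map snd (?qs \<sigma>)) = snd p"
        using composite_path(2)[OF ne sub that(1)] unfolding hdq that(2,3) by simp
      ultimately show ?thesis unfolding ok_def chain by metis
    qed
    have "(\<Sum>\<sigma> | \<sigma> permutes {1..?N}. sign \<sigma> * of_bool (\<forall>l\<le>?N. t (\<sigma> l) = s (\<sigma> (cyclic_succ ?N l)))) = (0::int)"
    proof (rule signed_trails_eq_0[OF W])
      show "s i \<in> W" if "i \<le> ?N" for i
        using that True path_end_closed[OF EW p] by (auto simp: s_def Suc_le_eq)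
    qed
    moreover have "(\<Sum>\<sigma> | \<sigma> permutes {1..?N}. sign \<sigma> * of_bool (ok \<sigma>)) =
        (\<Sum>\<sigma> | \<sigma> permutes {1..?N}. sign \<sigma> * of_bool (\<forall>l\<le>?N. t (\<sigma> l) = s (\<sigma> (cyclic_succ ?N l))) :: int)"
      by (intro sum.cong refl) (simp only: mem_Collect_eq ok_iff)
    ultimately show ?thesis by (simp only:)
  next
    case False
    have "\<not> ok \<sigma>" if \<sigma>: "\<sigma> permutes {1..?N}" for \<sigma>
    proof
      assume ok: "ok \<sigma>"
      have ne: "?qs \<sigma> \<noteq> []" using L(1) by simp
      have sub: "set (?qs \<sigma>) \<subseteq> paths G" using h by auto
      have setE: "set (concat (map snd (?qs \<sigma>))) \<subseteq> E" using ok p(3) by (simp add: ok_def)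
      have "fst (hd (?qs \<sigma>)) \<in> W" using ok p(2) L by (simp add: ok_def hd_map)
      from composite_starts[OF EW ne sub _ this setE] ok
      have "\<forall>q\<in>h ` {1..?N}. fst q \<in> W" unfolding set_qs[OF \<sigma>] by (simp add: ok_def)
      moreover have "\<forall>q\<in>set (?qs \<sigma>). set (snd q) \<subseteq> E" using setE by auto
      then have "\<forall>q\<in>h ` {1..?N}. set (snd q) \<subseteq> E" unfolding set_qs[OF \<sigma>] .
      moreover have "(\<Sum>i\<in>{1..?N}. length (snd (h i))) = length (snd p)"
      proof -
        have "length (snd p) = length (concat (map snd (?qs \<sigma>)))" using ok by (simp add: ok_def)
        also have "\<dots> = (\<Sum>i\<in>{1..?N}. length (snd (h (\<sigma> i))))"
          using sum.distinct_set_conv_list[OF dL, of "\<lambda>i. length (snd (h (\<sigma> i)))"]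
            by (simp add: length_concat setL comp_def)
        also have "\<dots> = (\<Sum>i\<in>{1..?N}. length (snd (h i)))"
          using sum.permute[OF \<sigma>, of "\<lambda>i. length (snd (h i))"] by (simp add: comp_def)
        finally show ?thesis by simp
      qed
      ultimately show False using False by blast
    qed
    then show ?thesis by (intro sum.neutral) auto
  qed
  note zero = this
  have "Poly_Mapping.lookup (std_val G ?N (\<lambda>i. Poly_Mapping.single (h i) (c i))) p =
      (\<Sum>\<sigma> | \<sigma> permutes {1..?N}. of_int (sign \<sigma>) * (of_bool (ok \<sigma>) * (\<Prod>i\<in>{1..?N}. c i)))"
    unfolding std_val_def lookup_sum lookup_scale
    by (intro sum.cong refl) (simp only: mem_Collect_eq ws L_def[symmetric])
  also have "\<dots> = of_int (\<Sum>\<sigma> | \<sigma> permutes {1..?N}. sign \<sigma> * of_bool (ok \<sigma>)) * (\<Prod>i\<in>{1..?N}. c i)"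
    by (simp add: sum_distrib_right mult.assoc)
  also have "\<dots> = 0" unfolding zero by simp
  finally show "Poly_Mapping.lookup (std_val G ?N (\<lambda>i. Poly_Mapping.single (h i) (c i))) p = 0" .
qed

end

section \<open>Evaluation of noncommutative polynomials\<close>

lemma prod_list_nc_var:
  "prod_list (map (\<lambda>i. nc_var (g i)) l) = (Poly_Mapping.single (Word (map g l)) 1 :: 'f::field nc_poly)"
proof (induction l)
  case Nil
  show ?case by (simp flip: zero_nc_word_def)
qed (simp add: nc_var_def mult_single plus_nc_word_def)

lemma St_nc_var:
  "St r (\<lambda>i. nc_var (g i)) = (\<Sum>\<sigma> | \<sigma> permutes {1..r}.
     Poly_Mapping.single (Word (map (g \<circ> \<sigma>) [1..<Suc r])) (of_int (sign \<sigma>)) :: 'f::field nc_poly)"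
  unfolding St_def
proof (intro sum.cong refl)
  fix \<sigma>
  have "of_int (sign \<sigma>) * prod_list (map (\<lambda>i. nc_var (g (\<sigma> i))) [1..<Suc r]) =
      (Poly_Mapping.single 0 (of_int (sign \<sigma>)) * Poly_Mapping.single (Word (map (\<lambda>i. g (\<sigma> i)) [1..<Suc r])) 1 :: 'f nc_poly)"
    unfolding prod_list_nc_var single_of_int ..
  also have "\<dots> = Poly_Mapping.single (Word (map (g \<circ> \<sigma>) [1..<Suc r])) (of_int (sign \<sigma>))"
    unfolding mult_single by (simp add: comp_def del: upt_Suc)
  finally show "of_int (sign \<sigma>) * prod_list (map (\<lambda>i. nc_var (g (\<sigma> i))) [1..<Suc r]) =
      (Poly_Mapping.single (Word (map (g \<circ> \<sigma>) [1..<Suc r])) (of_int (sign \<sigma>)) :: 'f nc_poly)" .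
qed

text \<open>The monomial \<open>x_1 x_2 ... x_2r\<close> has coefficient \<open>1\<close>: both
  halves have length \<open>r\<close>, so it arises only from the pair of identity
  permutations.\<close>

lemma St_mult_St_nonzero:
  fixes r :: nat
  shows "St r nc_var * St r (\<lambda>i. nc_var (r + i)) \<noteq> (0 :: 'f::field nc_poly)"
proof
  define L where "L = [1..<Suc r]"
  define w where "w = Word (L @ map ((+) r) L)"
  assume 0: "St r nc_var * St r (\<lambda>i. nc_var (r + i)) = (0 :: 'f nc_poly)"
  have id: "\<sigma> = id" if "\<sigma> permutes {1..r}" "map \<sigma> L = L" for \<sigma>
  proof
    fix i
    have "map \<sigma> L = map id L" using that(2) by simp
    then have "\<forall>i\<in>set L. \<sigma> i = id i" by (simp only: map_eq_conv)
    moreover have "i \<notin> set L \<Longrightarrow> \<sigma> i = id i"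
      using permutes_not_in[OF that(1), of i] by (auto simp: L_def)
    ultimately show "\<sigma> i = id i" by blast
  qed
  have eq: "Word (map \<sigma> L) + Word (map ((+) r \<circ> \<tau>) L) = w \<longleftrightarrow> \<sigma> = id \<and> \<tau> = id"
    if "\<sigma> permutes {1..r}" "\<tau> permutes {1..r}" for \<sigma> \<tau>
  proof -
    have "Word (map \<sigma> L) + Word (map ((+) r \<circ> \<tau>) L) = w \<longleftrightarrow>
        map \<sigma> L = L \<and> map ((+) r) (map \<tau> L) = map ((+) r) L"
      by (simp add: w_def plus_nc_word_def append_eq_append_conv)
    also have "\<dots> \<longleftrightarrow> map \<sigma> L = L \<and> map \<tau> L = L"
      by (metis inj_map_eq_map inj_on_add)
    finally show ?thesis using id that by auto
  qed
  have "St r nc_var * St r (\<lambda>i. nc_var (r + i)) =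
      (\<Sum>\<sigma> | \<sigma> permutes {1..r}. \<Sum>\<tau> | \<tau> permutes {1..r}.
        Poly_Mapping.single (Word (map \<sigma> L) + Word (map ((+) r \<circ> \<tau>) L)) (of_int (sign \<sigma> * sign \<tau>)) :: 'f nc_poly)"
    unfolding St_nc_var[of r "\<lambda>i. i", simplified comp_def] St_nc_var[of r "\<lambda>i. r + i"] sum_product L_def
    by (simp add: mult_single comp_def del: upt_Suc)
  then have "Poly_Mapping.lookup (St r nc_var * St r (\<lambda>i. nc_var (r + i)) :: 'f nc_poly) w =
      (\<Sum>\<sigma> | \<sigma> permutes {1..r}. \<Sum>\<tau> | \<tau> permutes {1..r}.
        if \<sigma> = id \<and> \<tau> = id then 1 else 0)"
    by (auto simp: lookup_sum lookup_single when_def eq intro!: sum.cong)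
  also have "\<dots> = (\<Sum>\<sigma> | \<sigma> permutes {1..r}. if \<sigma> = id then 1 else 0)"
    by (intro sum.cong refl) (auto simp: finite_permutations permutes_id)
  also have "\<dots> = 1" by (simp add: finite_permutations permutes_id)
  finally show False using 0 by simp
qed

section \<open>Evaluation in a path algebra and in its quotients\<close>

definition path_nc_eval :: "('v, 'e) pre_digraph \<Rightarrow> (nat \<Rightarrow> (('v, 'e) path \<Rightarrow>\<^sub>0 'f::field)) \<Rightarrow> 'f nc_poly
    \<Rightarrow> (('v, 'e) path \<Rightarrow>\<^sub>0 'f)" where
  "path_nc_eval Q x f =
     (\<Sum>w\<in>Poly_Mapping.keys f. scale (Poly_Mapping.lookup f w) (word_val Q x (letters w)))"

lemma path_nc_eval_superset:
  assumes "finite S" "Poly_Mapping.keys f \<subseteq> S"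
  shows "path_nc_eval Q x f = (\<Sum>w\<in>S. scale (Poly_Mapping.lookup f w) (word_val Q x (letters w)))"
  unfolding path_nc_eval_def
  by (rule sum.mono_neutral_left) (use assms in \<open>auto simp: in_keys_iff\<close>)

lemma path_nc_eval_add: "path_nc_eval Q x (f + g) = path_nc_eval Q x f + path_nc_eval Q x g"
proof -
  let ?S = "Poly_Mapping.keys f \<union> Poly_Mapping.keys g"
  have "path_nc_eval Q x h = (\<Sum>w\<in>?S. scale (Poly_Mapping.lookup h w) (word_val Q x (letters w)))"
    if "Poly_Mapping.keys h \<subseteq> ?S" for h
    using that by (intro path_nc_eval_superset) auto
  from this[of "f + g"] this[of f] this[of g] show ?thesis
    using keys_add[of f g] by (simp add: lookup_add scale_add_left sum.distrib)
qed

lemma path_nc_eval_sum: "path_nc_eval Q x (sum f A) = (\<Sum>i\<in>A. path_nc_eval Q x (f i))"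
  by (induction A rule: infinite_finite_induct)
    (simp_all add: path_nc_eval_add path_nc_eval_def[of _ _ 0])

lemma path_nc_eval_single:
  "path_nc_eval Q x (Poly_Mapping.single w c) = scale c (word_val Q x (letters w))"
  by (simp add: path_nc_eval_def)

context fin_digraph
begin

lemma path_nc_eval_St_mult_St:
  assumes x: "\<And>i. Poly_Mapping.keys (x i) \<subseteq> paths G"
  shows "path_nc_eval G x (St r nc_var * St r (\<lambda>i. nc_var (r + i))) =
    path_mult G (std_val G r x) (std_val G r (\<lambda>i. x (r + i)))"
proof -
  have *: "path_nc_eval G x (Poly_Mapping.single (Word (map \<sigma> L)) c * Poly_Mapping.single (Word (map (\<lambda>i. r + \<tau> i) L)) d)
    = path_mult G (scale c (word_val G x (map \<sigma> L))) (scale d (word_val G (\<lambda>i. x (r + i)) (map \<tau> L)))"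
    for \<sigma> \<tau> :: "nat \<Rightarrow> nat" and L c d
  proof -
    have "word_val G x (map (\<lambda>i. r + \<tau> i) L) = word_val G (\<lambda>i. x (r + i)) (map \<tau> L)"
      by (simp only: word_val_map comp_def)
    then show ?thesis
      using word_val_append[of x, OF x, of "map \<sigma> L" "map (\<lambda>i. r + \<tau> i) L"]
      by (simp add: mult_single plus_nc_word_def path_nc_eval_single path_mult_scale_left
          path_mult_scale_right scale_scale mult.commute)
  qed
  show ?thesis
    unfolding St_nc_var[of r "\<lambda>i. i", simplified comp_def] St_nc_var[of r "\<lambda>i. r + i", unfolded comp_def] sum_product
    unfolding path_nc_eval_sum * std_val_def path_mult_sum_left path_mult_sum_right
    \<comment> \<open>The two expansions nest the sums over the two permutations in opposite
      orders.\<close>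
    by (rule sum.swap)
qed

text \<open>The coset map is a ring homomorphism and respects scalars by
  \<open>quotient_smult\<close>, so it commutes with evaluation.\<close>

lemma nc_eval_quotient:
  fixes x :: "nat \<Rightarrow> (('a, 'b) path \<Rightarrow>\<^sub>0 'f::field)"
  assumes I: "ideal I (path_algebra G)"
    and x: "\<And>i. Poly_Mapping.keys (x i) \<subseteq> paths G"
  shows "nc_eval (quotient_algebra (path_algebra G) I) (\<lambda>i. I +>\<^bsub>path_algebra G\<^esub> x i) f =
    I +>\<^bsub>path_algebra G\<^esub> path_nc_eval G x f"
proof -
  let ?R = "path_algebra G :: ('f, ('a, 'b) path \<Rightarrow>\<^sub>0 'f) module"
  let ?A = "quotient_algebra ?R I"
  interpret I: ideal I ?R by fact
  interpret Q: ring "?R Quot I" by (rule I.quotient_is_ring)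
  interpret h: ring_hom_ring ?R "?R Quot I" "(+>\<^bsub>?R\<^esub>) I" by (rule I.rcos_ring_hom_ring)
  \<comment> \<open>The sum in \<open>nc_eval\<close> is taken in the record \<open>?A\<close>,
    which extends the quotient ring by scalars, so the laws of finite sums are needed for
    \<open>?A\<close> itself.\<close>
  interpret A: abelian_monoid ?A
    by (rule abelian_monoidI) (simp_all add: Q.a_ac)
  have carr: "y \<in> carrier ?R \<longleftrightarrow> Poly_Mapping.keys y \<subseteq> paths G" for y
    by (simp add: path_algebra_def)
  have word: "foldr (\<lambda>i y. (I +>\<^bsub>?R\<^esub> x i) \<otimes>\<^bsub>?A\<^esub> y) ws \<one>\<^bsub>?A\<^esub> = I +>\<^bsub>?R\<^esub> word_val G x ws" for ws
  proof (induction ws)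
    case Nil
    have "\<one>\<^bsub>?R Quot I\<^esub> = I +>\<^bsub>?R\<^esub> \<one>\<^bsub>?R\<^esub>" by (simp only: h.hom_one)
    then show ?case by (simp add: word_val_def path_algebra_def)
  next
    case (Cons i ws)
    have "I +>\<^bsub>?R\<^esub> (x i \<otimes>\<^bsub>?R\<^esub> word_val G x ws) =
        (I +>\<^bsub>?R\<^esub> x i) \<otimes>\<^bsub>?R Quot I\<^esub> (I +>\<^bsub>?R\<^esub> word_val G x ws)"
      by (rule h.hom_mult) (use x word_val_carrier[of x, OF x] in \<open>simp_all add: carr\<close>)
    then show ?case using Cons by (simp add: word_val_Cons) (simp add: path_algebra_def)
  qed
  have "finsum ?A (\<lambda>w. Poly_Mapping.lookup f w \<odot>\<^bsub>?A\<^esub>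
      foldr (\<lambda>i y. (I +>\<^bsub>?R\<^esub> x i) \<otimes>\<^bsub>?A\<^esub> y) (letters w) \<one>\<^bsub>?A\<^esub>) K =
      I +>\<^bsub>?R\<^esub> (\<Sum>w\<in>K. scale (Poly_Mapping.lookup f w) (word_val G x (letters w)))"
    (is "finsum ?A ?t K = I +>\<^bsub>?R\<^esub> (\<Sum>w\<in>K. ?s w)") if "finite K" for K
  proof -
    have sc: "?s w \<in> carrier ?R" for w
      using word_val_carrier[of x, OF x, of "letters w"] by (auto simp: carr in_keys_iff lookup_scale)
    have t: "?t w = I +>\<^bsub>?R\<^esub> ?s w" for w
      unfolding word
      by (subst quotient_smult[OF I]) (use word_val_carrier[of x, OF x] in \<open>simp_all add: carr, simp add: path_algebra_def\<close>)
    have "finsum ?A (\<lambda>w. I +>\<^bsub>?R\<^esub> ?s w) K = I +>\<^bsub>?R\<^esub> (\<Sum>w\<in>K. ?s w)"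
      using that
    proof (induction K rule: finite_induct)
      case empty
      have "\<zero>\<^bsub>?R\<^esub> = 0" by (simp add: path_algebra_def)
      then have "\<zero>\<^bsub>?A\<^esub> = I +>\<^bsub>?R\<^esub> 0" using h.hom_zero by simp
      then show ?case by (simp only: A.finsum_empty sum.empty)
    next
      case (insert w K)
      have sK: "(\<Sum>w\<in>K. ?s w) \<in> carrier ?R"
        using sc by (auto simp: carr dest!: subsetD[OF keys_sum])
      have "finsum ?A (\<lambda>w. I +>\<^bsub>?R\<^esub> ?s w) (insert w K) =
          (I +>\<^bsub>?R\<^esub> ?s w) \<oplus>\<^bsub>?A\<^esub> (I +>\<^bsub>?R\<^esub> (\<Sum>w\<in>K. ?s w))"
        using insert.hyps h.hom_closed[OF sc] unfolding insert.IH[symmetric] by (intro A.finsum_insert) auto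
      also have "\<dots> = I +>\<^bsub>?R\<^esub> (?s w \<oplus>\<^bsub>?R\<^esub> (\<Sum>w\<in>K. ?s w))"
        unfolding quotient_algebra_simps by (rule h.hom_add[OF sc sK, symmetric])
      also have "?s w \<oplus>\<^bsub>?R\<^esub> (\<Sum>w\<in>K. ?s w) = (\<Sum>w\<in>insert w K. ?s w)"
        using insert.hyps by (simp add: path_algebra_def)
      finally show ?case .
    qed
    then show ?thesis unfolding t .
  qed
  from this[OF finite_keys[of f]] show ?thesis unfolding nc_eval_def path_nc_eval_def .
qed

section \<open>Membership in the ideal generated by a path\<close>

lemma ideal_sum:
  fixes f :: "'i \<Rightarrow> (('a, 'b) path \<Rightarrow>\<^sub>0 'f::field)"
  assumes I: "ideal I (path_algebra G)" and f: "\<And>i. i \<in> A \<Longrightarrow> f i \<in> I"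
  shows "sum f A \<in> I"
proof -
  let ?R = "path_algebra G :: ('f, ('a, 'b) path \<Rightarrow>\<^sub>0 'f) module"
  interpret I: ideal I ?R by fact
  have 0: "0 \<in> I" using additive_subgroup.zero_closed[OF I.additive_subgroup_axioms] by (simp add: path_algebra_def)
  have add: "x + y \<in> I" if "x \<in> I" "y \<in> I" for x y
    using additive_subgroup.a_closed[OF I.additive_subgroup_axioms that] by (simp add: path_algebra_def)
  show ?thesis
    using f by (induction A rule: infinite_finite_induct) (auto simp: 0 add)
qed

text \<open>The path is a product with the generator as middle factor; the left factor carries the
  scalar \<open>c\<close>.\<close>

lemma single_in_genideal:
  fixes c :: "'f::field"
  assumes p: "(u, xs @ ps @ ys) \<in> paths G" and "v = path_end G (u, xs)"
  shows "Poly_Mapping.single (u, xs @ ps @ ys) c \<in> genideal (path_algebra G) {path_elem (v, ps)}"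
proof -
  let ?R = "path_algebra G :: ('f, ('a, 'b) path \<Rightarrow>\<^sub>0 'f) module"
  interpret R: ring ?R by (rule ring_path_algebra)
  obtain z where z: "awalk u (xs @ ps @ ys) z" using p by (auto simp: paths_def)
  define v' where "v' = path_end G (v, ps)"
  have w: "awalk u xs v" "awalk v ps v'" "awalk v' ys z"
    using z assms(2) by (auto simp: path_end_def v'_def)
  have pth: "(u, xs) \<in> paths G" "(v, ps) \<in> paths G" "(v', ys) \<in> paths G"
    using w by (auto simp: paths_def)
  have carr: "Poly_Mapping.single q d \<in> carrier ?R" if "q \<in> paths G" for q and d :: 'f
    using that by (auto simp: path_algebra_def)
  have I: "ideal (genideal ?R {path_elem (v, ps)}) ?R"
    by (rule R.genideal_ideal) (use carr pth in \<open>auto simp: path_elem_def\<close>)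
  interpret I: ideal "genideal ?R {path_elem (v, ps)}" ?R by (rule I)
  have "path_elem (v, ps) \<in> genideal ?R {path_elem (v, ps)}"
    by (rule R.genideal_self') (use carr pth in \<open>auto simp: path_elem_def\<close>)
  then have "Poly_Mapping.single (u, xs) c \<otimes>\<^bsub>?R\<^esub> (path_elem (v, ps) \<otimes>\<^bsub>?R\<^esub> Poly_Mapping.single (v', ys) 1)
      \<in> genideal ?R {path_elem (v, ps)}"
    using carr pth by (intro I.I_l_closed I.I_r_closed) auto
  also have "Poly_Mapping.single (u, xs) c \<otimes>\<^bsub>?R\<^esub> (path_elem (v, ps) \<otimes>\<^bsub>?R\<^esub> Poly_Mapping.single (v', ys) 1)
      = Poly_Mapping.single (u, xs @ ps @ ys) c"
    using assms(2) v'_def by (simp add: path_algebra_def path_elem_def path_mult_single path_single_mult_def)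
  finally show ?thesis .
qed

end

text \<open>Applied with \<open>P\<close> meaning "arrow of the first cycle", this locates where a
  path passes directly from the first cycle to the second.\<close>

lemma list_switch:
  assumes "P a" "\<exists>b\<in>set zs. \<not> P b"
  shows "\<exists>xs x y ys. a # zs = xs @ [x, y] @ ys \<and> P x \<and> \<not> P y"
  using assms
proof (induction zs arbitrary: a)
  case (Cons z zs)
  show ?case
  proof (cases "P z")
    case True
    then obtain xs x y ys where "z # zs = xs @ [x, y] @ ys" "P x" "\<not> P y"
      using Cons.IH[of z] Cons.prems by auto
    then show ?thesis by (intro exI[of _ "a # xs"]) auto
  next
    case False
    then show ?thesis using Cons.prems by (intro exI[of _ "[]"]) auto
  qed
qed simp

section \<open>Gluing two oriented cycles\<close>

lemma (in fin_digraph) std_val_carrier: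
  assumes "\<And>i. Poly_Mapping.keys (x i) \<subseteq> paths G"
  shows "Poly_Mapping.keys (std_val G r x) \<subseteq> paths G"
  unfolding std_val_def
proof (rule order.trans[OF keys_sum UN_least])
  fix \<sigma>
  show "Poly_Mapping.keys (scale (of_int (sign \<sigma>)) (word_val G x (map \<sigma> [1..<Suc r]))) \<subseteq> paths G"
    using word_val_carrier[of x "map \<sigma> [1..<Suc r]", OF assms]
    by (auto simp: in_keys_iff lookup_scale simp del: upt_Suc)
qed

theorem theorem8p1:
  fixes n m k :: nat
    and u w \<alpha> \<beta> :: nat
    and Q :: "(nat + nat, nat + nat) pre_digraph"
    and FQ A
  assumes "n \<ge> 1" and "m \<ge> 1"
    and "u \<in> verts (oriented_cycle n)" and "w \<in> verts (oriented_cycle m)"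
    and "\<alpha> \<in> arcs (oriented_cycle n)" and "head (oriented_cycle n) \<alpha> = u"
    and "\<beta> \<in> arcs (oriented_cycle m)" and "tail (oriented_cycle m) \<beta> = w"
  defines "Q \<equiv> glue (oriented_cycle n) u (oriented_cycle m) w"
    and "FQ \<equiv> (path_algebra Q :: ('f::field, (nat + nat, nat + nat) path \<Rightarrow>\<^sub>0 'f) module)"
    and "A \<equiv> quotient_algebra FQ (genideal FQ {path_elem (tail Q (Inl \<alpha>), [Inl \<alpha>, Inr \<beta>])})"
    and "k \<equiv> max n m"
  shows "PI_algebra A \<and>
    polynomial_identity A (St (2 * k) nc_var * St (2 * k) (\<lambda>i. nc_var (2 * k + i)))"
proof -
  define \<iota> where "\<iota> = (\<lambda>x. if x = w then Inl u else Inr x :: nat + nat)"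
  have inj_\<iota>: "inj \<iota>" by (auto simp: \<iota>_def inj_on_def)
  have u: "u \<in> {1..n}" and \<alpha>: "\<alpha> \<in> {1..n}" "(if \<alpha> = n then 1 else \<alpha> + 1) = u"
    and \<beta>: "\<beta> \<in> {1..m}" "\<beta> = w"
    using assms(3-8) by (simp_all add: oriented_cycle_def)
  have verts_Q: "verts Q = Inl ` {1..n} \<union> \<iota> ` {1..m}"
    and arcs_Q: "arcs Q = Inl ` {1..n} \<union> Inr ` {1..m}"
    and tail_Q: "\<And>e. tail Q (Inl e) = Inl e" "\<And>e. tail Q (Inr e) = \<iota> e"
    and head_Q: "\<And>e. head Q (Inl e) = Inl (if e = n then 1 else e + 1)"
      "\<And>e. head Q (Inr e) = \<iota> (if e = m then 1 else e + 1)"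
    by (simp_all add: Q_def glue_def oriented_cycle_def \<iota>_def)
  \<comment> \<open>Each vertex of the first cycle receives only one of its arrows; this later
    identifies an arrow as \<open>\<alpha>\<close>.\<close>
  have inj_next: "inj_on (\<lambda>e. if e = n then 1 else e + 1) {1..n}"
    by (auto simp: inj_on_def)
  interpret Q: fin_digraph Q
    unfolding Q_def by (intro fin_digraph_glue fin_digraph_oriented_cycle assms(3))

  have mixed: "p \<in> paths Q \<and> (\<exists>e. Inl e \<in> set (snd p)) \<and> (\<exists>e. Inr e \<in> set (snd p))"
    if x: "\<And>i. Poly_Mapping.keys (x i) \<subseteq> paths Q"
      and p: "p \<in> Poly_Mapping.keys (std_val Q (2 * k) x)" for x and p
  proof -
    have pth: "p \<in> paths Q" using Q.std_val_carrier[of x, OF x] p by blast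
    have nz: "Poly_Mapping.lookup (std_val Q (2 * k) x) p \<noteq> 0" using p by (simp add: in_keys_iff)
    have start: "fst p \<in> verts Q" using pth by (auto simp: paths_def)
    have first: "tail Q e = fst p \<and> e \<in> arcs Q" if "snd p = e # es" for e es
      using pth that by (auto simp: paths_def Q.awalk_Cons_iff)
    \<comment> \<open>Here \<open>E\<close> consists of the arrows tagged \<open>Inl\<close> and
      \<open>W\<close> of the \<open>n \<le> k\<close> vertices of the first cycle. Lazy paths are
      covered as well.\<close>
    have zero1: "\<not> (fst p \<in> Inl ` {1..n} \<and> set (snd p) \<subseteq> range Inl)"
    proof
      assume "fst p \<in> Inl ` {1..n} \<and> set (snd p) \<subseteq> range Inl"
      then have "Poly_Mapping.lookup (std_val Q (2 * k) x) p = 0"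
        using pth x assms(1)
        by (intro Q.lookup_std_val_eq_0[of "range Inl" "Inl ` {1..n}"])
          (auto simp: inj_on_def tail_Q head_Q arcs_Q card_image k_def)
      with nz show False by simp
    qed
    have zero2: "\<not> (fst p \<in> \<iota> ` {1..m} \<and> set (snd p) \<subseteq> range Inr)"
    proof
      assume "fst p \<in> \<iota> ` {1..m} \<and> set (snd p) \<subseteq> range Inr"
      then have "Poly_Mapping.lookup (std_val Q (2 * k) x) p = 0"
        using pth x assms(2) inj_\<iota>
        by (intro Q.lookup_std_val_eq_0[of "range Inr" "\<iota> ` {1..m}"])
          (auto simp: inj_on_def tail_Q head_Q arcs_Q card_image k_def dest: injD)
      with nz show False by simp
    qed
    have "\<exists>e. Inl e \<in> set (snd p)"
    proof (rule ccontr)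
      assume no: "\<nexists>e. Inl e \<in> set (snd p)"
      then have Inr: "set (snd p) \<subseteq> range Inr" by (metis rangeI subsetI sum.exhaust)
      show False
      proof (cases "snd p")
        \<comment> \<open>A lazy path sits at a vertex of one of the cycles, so \<open>zero1\<close>
          or \<open>zero2\<close> excludes it.\<close>
        case Nil
        then show False using zero1 zero2 start by (auto simp: verts_Q)
      next
        case (Cons e es)
        then have "fst p \<in> \<iota> ` {1..m}" using first[OF Cons] Inr by (force simp: tail_Q arcs_Q)
        then show False using zero2 Inr by simp
      qed
    qed
    moreover have "\<exists>e. Inr e \<in> set (snd p)"
    proof (rule ccontr)
      assume no: "\<nexists>e. Inr e \<in> set (snd p)"
      then have Inl: "set (snd p) \<subseteq> range Inl" by (metis rangeI subsetI sum.exhaust)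
      show False
      proof (cases "snd p")
        case Nil
        then show False using zero1 zero2 start by (auto simp: verts_Q)
      next
        case (Cons e es)
        then have "fst p \<in> Inl ` {1..n}" using first[OF Cons] Inl by (force simp: tail_Q arcs_Q)
        then show False using zero1 Inl by simp
      qed
    qed
    ultimately show ?thesis using pth by blast
  qed

  let ?I = "genideal FQ {path_elem (tail Q (Inl \<alpha>), [Inl \<alpha>, Inr \<beta>])}"
  interpret R: ring FQ unfolding FQ_def by (rule Q.ring_path_algebra)
  have arc: "Inl \<alpha> \<in> arcs Q" "Inr \<beta> \<in> arcs Q" "head Q (Inl \<alpha>) = tail Q (Inr \<beta>)"
    using \<alpha>(1) \<beta> by (auto simp: arcs_Q tail_Q head_Q(1) \<alpha>(2) \<iota>_def)
  then have "Q.awalk (tail Q (Inl \<alpha>)) [Inl \<alpha>, Inr \<beta>] (head Q (Inr \<beta>))"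
    by (simp add: Q.awalk_Cons_iff Q.awalk_Nil_iff)
  then have "(tail Q (Inl \<alpha>), [Inl \<alpha>, Inr \<beta>]) \<in> paths Q"
    unfolding paths_def by blast
  then have I: "ideal ?I FQ"
    by (intro R.genideal_ideal) (simp add: FQ_def path_algebra_def path_elem_def)

  have single_I: "Poly_Mapping.single (fst p, snd p @ snd q) c \<in> ?I"
    if p: "p \<in> paths Q" "Inl e \<in> set (snd p)" and q: "q \<in> paths Q" "Inr f \<in> set (snd q)"
      and pq: "path_end Q p = fst q" for p q e f c
  proof -
    obtain l1 l2 where l: "snd p = l1 @ Inl e # l2" using p(2) by (meson split_list)
    \<comment> \<open>Reading on from an arrow of the first cycle, an arrow of the second must come,
      so somewhere two adjacent arrows switch cycles.\<close>
    have "isl (Inl e :: nat + nat)" "\<exists>b\<in>set (l2 @ snd q). \<not> isl b" using q(2) by force+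
    from list_switch[of isl, OF this] obtain xs a b ys where
      ab: "Inl e # l2 @ snd q = xs @ [Inl a, Inr b] @ ys"
      by (metis isl_def sum.exhaust)
    have eq: "snd p @ snd q = (l1 @ xs) @ [Inl a, Inr b] @ ys" using l ab by simp
    have pth: "(fst p, (l1 @ xs) @ [Inl a, Inr b] @ ys) \<in> paths Q"
      using Q.path_append[OF p(1) q(1) pq] unfolding eq .
    then obtain z where "Q.awalk (fst p) ((l1 @ xs) @ [Inl a, Inr b] @ ys) z"
      by (auto simp: paths_def)
    then have "Q.awalk (path_end Q (fst p, l1 @ xs)) ([Inl a, Inr b] @ ys) z"
      unfolding Q.awalk_append_iff[of _ "l1 @ xs"] by (simp add: path_end_def)
    then have v: "path_end Q (fst p, l1 @ xs) = tail Q (Inl a)" and a: "a \<in> {1..n}"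
      and h: "head Q (Inl a) = tail Q (Inr b)"
      by (auto simp: Q.awalk_Cons_iff arcs_Q)
    \<comment> \<open>The head of \<open>Inl a\<close> is an \<open>Inl\<close> vertex, and
      \<open>\<iota> b\<close> is one only for \<open>b = w\<close>. So the switch happens at the
      common vertex, which only \<open>\<alpha>\<close> enters in the first cycle and only
      \<open>\<beta>\<close> leaves in the second.\<close>
    have "b = \<beta>" "(if a = n then 1 else a + 1) = u"
      using h \<beta>(2) by (auto simp: head_Q tail_Q \<iota>_def split: if_splits)
    moreover from this(2) have "a = \<alpha>"
      by (intro inj_onD[OF inj_next _ a \<alpha>(1)]) (simp only: \<alpha>(2))
    ultimately show ?thesis
      using Q.single_in_genideal[OF pth v[symmetric], of c] unfolding eq FQ_def by simp
  qed

  have "polynomial_identity A (St (2 * k) nc_var * St (2 * k) (\<lambda>i. nc_var (2 * k + i)))"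
    unfolding polynomial_identity_def
  proof (intro allI impI)
    fix a :: "nat \<Rightarrow> _" assume "\<forall>i. a i \<in> carrier A"
    then have "\<forall>i. \<exists>x. x \<in> carrier FQ \<and> a i = ?I +>\<^bsub>FQ\<^esub> x"
      by (auto simp: A_def FactRing_simps)
    then obtain x where "\<And>i. x i \<in> carrier FQ" and a: "\<And>i. a i = ?I +>\<^bsub>FQ\<^esub> x i" by metis
    then have x: "\<And>i. Poly_Mapping.keys (x i) \<subseteq> paths Q" by (simp add: FQ_def path_algebra_def)
    let ?f = "St (2 * k) nc_var * St (2 * k) (\<lambda>i. nc_var (2 * k + i)) :: 'f nc_poly"
    let ?S = "std_val Q (2 * k) x" and ?T = "std_val Q (2 * k) (\<lambda>i. x (2 * k + i))"
    have "a = (\<lambda>i. ?I +>\<^bsub>FQ\<^esub> x i)" using a by blast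
    then have "nc_eval A a ?f = ?I +>\<^bsub>FQ\<^esub> path_mult Q ?S ?T"
      using Q.nc_eval_quotient[of ?I x ?f] I x
      unfolding A_def FQ_def by (simp add: Q.path_nc_eval_St_mult_St)
    \<comment> \<open>Each term is zero or lies in the ideal by \<open>single_I\<close>, which takes
      an arrow of the first cycle from the left factor and one of the second from the right.\<close>
    moreover have "path_mult Q ?S ?T \<in> ?I"
      unfolding path_mult_eq FQ_def
    proof ((rule Q.ideal_sum[OF I[unfolded FQ_def]])+)
      fix p q assume "p \<in> Poly_Mapping.keys ?S" "q \<in> Poly_Mapping.keys ?T"
      then have "p \<in> paths Q" "\<exists>e. Inl e \<in> set (snd p)" "q \<in> paths Q" "\<exists>e. Inr e \<in> set (snd q)"
        using mixed[of x p, OF x] mixed[of "\<lambda>i. x (2 * k + i)" q, OF x] by simp_all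
      then have "path_end Q p = fst q \<Longrightarrow> Poly_Mapping.single (fst p, snd p @ snd q) c \<in> ?I" for c
        using single_I by blast
      moreover have "\<zero>\<^bsub>FQ\<^esub> = 0" by (simp add: FQ_def path_algebra_def)
      then have "0 \<in> ?I"
        using additive_subgroup.zero_closed[OF ideal.axioms(1)[OF I]] by (simp only:)
      ultimately have "path_single_mult Q p q c \<in> ?I" for c
        by (simp add: path_single_mult_def)
      then show "path_single_mult Q p q (Poly_Mapping.lookup ?S p * Poly_Mapping.lookup ?T q)
          \<in> genideal (path_algebra Q) {path_elem (tail Q (Inl \<alpha>), [Inl \<alpha>, Inr \<beta>])}"
        unfolding FQ_def .
    qed
    then have "?I +>\<^bsub>FQ\<^esub> path_mult Q ?S ?T = ?I"
      by (rule abelian_subgroup.a_rcos_const[OF abelian_subgroupI3[OF ideal.axioms(1)[OF I] R.is_abelian_group]])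
    ultimately have "nc_eval A a ?f = ?I" by (simp only:)
    then show "nc_eval A a ?f = \<zero>\<^bsub>A\<^esub>" by (simp add: A_def FactRing_def)
  qed
  then show ?thesis
    unfolding PI_algebra_def using St_mult_St_nonzero by blast
qed

end
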